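(* Let $\mathcal{A}=\langle Q,\Sigma,q^0,\delta_o,\delta_{o^2\to o},\rho\rangle$ be a weak alternating automaton whose signature contains only constants of type $o$ or $o\to o\to o$ and whose transition function is monotone, let $m$ be its maximal rank, and for $0\le k\le m$ let $\mathcal{D}^k$ be the stratified model described in the context, with constants interpreted as $[\![c]\!]^k=\{q\in Q_{\le k}: \delta_o(q,c)\neq\emptyset\}$ and $[\![a]\!]^k(S_0,S_1)=\{q\in Q_{\le k}: (S_0,S_1)\in\delta_{o^2\to o}(q,a)\}$. Then for every closed $\lambda Y$-term $M$ of type $o$ and every $0\le k\le m$, $[\![M]\!]^k=\mathcal{A}(M)\cap Q_{\le k}$, where $\mathcal{A}(M)$ is the set of states from which $\mathcal{A}$ accepts $BT(M)$.
   Context: Simple types are generated from the base type $o$ by $\to$. $\lambda Y$-terms are simply typed $\lambda$-terms built from variables, constants of the signature $\Sigma$, and for each type $A$ constants $Y^A:(A\to A)\to A$ and $\Omega^A:A$; $\Omega^A$ is regarded as an abbreviation of $Y^A(\lambda x^A.x)$. $BT(M)$ is the Böhm tree of $M$: if $M$ $\beta\delta$-reduces ($(\lambda x.M)N\to M[x:=N]$, $YM\to M(YM)$) to $\lambda\vec x.N_0N_1\dots N_k$ with $N_0$ a variable or constant, the root is labelled $\lambda\vec x.N_0$ with subtrees $BT(N_1),\dots,BT(N_k)$; otherwise it is a single node labelled $\Omega$. Automaton: $Q$ finite, $\rho:Q\to\mathbb{N}$, $\delta_o(q,c)\in\{\emptyset,\{()\}\}$ for $c$ of type $o$, $\delta_{o^2\to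 o}(q,a)\subseteq\mathcal{P}(Q)\times\mathcal{P}(Q)$ for $a$ of type $o\to o\to o$; weak: if $(S_0,S_1)\in\delta(q,a)$ then $S_0,S_1\subseteq Q_{\le\rho(q)}$; monotone: if $(S_0,S_1)\in\delta(q,a)$ and $S_j\subseteq S'_j\subseteq Q_{\le\rho(q)}$ then $(S'_0,S'_1)\in\delta(q,a)$. Acceptance game from node $v$ and state $q$: at a leaf labelled $c$ Eve wins iff $\delta_o(q,c)\ne\emptyset$; at a leaf labelled $\Omega$ Eve wins iff $\rho(q)$ is even; at a node labelled $a$ Eve picks $(S_0,S_1)\in\delta(q,a)$, Adam picks $j$ and $q'\in S_j$, and play moves to the $j$-th child with state $q'$; a player unable to move loses; in infinite plays ranks stabilize and Eve wins iff the eventual rank is even. $\mathcal{A}$ accepts from $q$ iff Eve has a winning strategy from the root. Stratified model. Let $m=\max\rho$, $Q_k=\{q:\rho(q)=k\}$, $Q_{\le k}=\{q:\rho(q)\le k\}$. Define by induction on $k\le m$ (and on types) sets $\mathcal{D}^k_A$, ordered by inclusion at $o$ and pointwise at arrow types, and for $k>0$ relations $\mathcal{L}^k_A\subseteq\mathcal{D}^{k-1}_A\times\mathcal{D}^k_A$: $\mathcal{D}^0_o=\mathcal{P}(Q_0)$, $\mathcal{D}^0_{A\to B}$ = all monotone maps $\mathcal{D}^0_A\to\mathcal{D}^0_B$; for $k>0$: $\mathcal{D}^k_o=\mathcal{P}(Q_{\le k})$, $\mathcal{L}^k_o=\{(R,P): R=P\cap Q_{\le k-1}\}$, $\mathcal{L}^k_{A\to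 B}=\{(f_1,f_2): f_1\in\mathcal{D}^{k-1}_{A\to B}$, $f_2$ a monotone map $\mathcal{D}^k_A\to\mathcal{D}^k_B$, and $(f_1(g_1),f_2(g_2))\in\mathcal{L}^k_B$ for all $(g_1,g_2)\in\mathcal{L}^k_A\}$, $\mathcal{D}^k_{A\to B}=\{f_2:\exists f_1,(f_1,f_2)\in\mathcal{L}^k_{A\to B}\}$. Each $\mathcal{D}^k_A$ is a finite lattice with greatest element $\top^k_A$; for $k>0$ every $e\in\mathcal{D}^k_A$ has a unique $e^{\downarrow}\in\mathcal{D}^{k-1}_A$ with $(e^\downarrow,e)\in\mathcal{L}^k_A$, and for $d\in\mathcal{D}^{k-1}_A$ the set $\{e:(d,e)\in\mathcal{L}^k_A\}$ has a greatest element $d^{\uparrow\top}$ and a least element $d^{\uparrow\bot}$. Fixpoint operators: for $f\in\mathcal{D}^0_{A\to A}$, $\mathrm{fix}^0_A(f)=\bigwedge_{n\ge0}f^n(\top^0_A)$; for $f\in\mathcal{D}^{2k}_{A\to A}$ with $2k>0$, $\mathrm{fix}^{2k}_A(f)=\bigwedge_{n\ge0}f^n(e)$ with $e=(\mathrm{fix}^{2k-1}_A(f^\downarrow))^{\uparrow\top}$; for $f\in\mathcal{D}^{2k+1}_{A\to A}$, $\mathrm{fix}^{2k+1}_A(f)=\bigvee_{n\ge0}f^n(d)$ with $d=(\mathrm{fix}^{2k}_A(f^\downarrow))^{\uparrow\bot}$. The interpretation $[\![M]\!]^k_\nu$ in $\mathcal{D}^k$ is the standard one: variables via the valuation $\nu$,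 application as function application, $\lambda x.M$ as $p\mapsto[\![M]\!]^k_{\nu[p/x]}$, $Y^A$ as $\mathrm{fix}^k_A$, and constants of $\Sigma$ as stated in the claim; $[\![M]\!]^k$ for closed $M$.
   Formalization: The interpretation of binary constants is corrected to {q in Q_{≤k} : (S_0∩Q_{≤ρ(q)}, S_1∩Q_{≤ρ(q)}) ∈ δ(q,a)}; with the literal formula, weakness makes the map non-monotone and the claim false (e.g. M = a c c with states of ranks 0 and 1). *)

theory Defs
  imports Main "HOL-Library.FSet"
begin

section \<open>Simply typed \<open>\<lambda>Y\<close>-terms\<close>

datatype ty = Base (\<open>\<o>\<close>) | Arr ty ty (infixr \<open>\<rightarrow>\<close> 65)

text \<open>Church-style terms with de Bruijn indices, over constants of type \<open>'c\<close>.\<close>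

datatype 'c tm =
    Var nat
  | Const 'c
  | Y ty
  | Lam ty "'c tm"
  | App "'c tm" "'c tm"

abbreviation Omega :: "ty \<Rightarrow> 'c tm" where
  "Omega A \<equiv> App (Y A) (Lam A (Var 0))"

text \<open>A signature maps its constants to their types and everything else to \<^const>\<open>None\<close>.\<close>

inductive has_type :: "('c \<Rightarrow> ty option) \<Rightarrow> ty list \<Rightarrow> 'c tm \<Rightarrow> ty \<Rightarrow> bool"
  for \<Sigma> :: "'c \<Rightarrow> ty option" where
  "i < length \<Gamma> \<Longrightarrow> has_type \<Sigma> \<Gamma> (Var i) (\<Gamma> ! i)"
| "\<Sigma> c = Some A \<Longrightarrow> has_type \<Sigma> \<Gamma> (Const c) A"
| "has_type \<Sigma> \<Gamma> (Y A) ((A \<rightarrow> A) \<rightarrow> A)"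
| "has_type \<Sigma> (A # \<Gamma>) M B \<Longrightarrow> has_type \<Sigma> \<Gamma> (Lam A M) (A \<rightarrow> B)"
| "has_type \<Sigma> \<Gamma> M (A \<rightarrow> B) \<Longrightarrow> has_type \<Sigma> \<Gamma> N A \<Longrightarrow> has_type \<Sigma> \<Gamma> (App M N) B"

primrec lift :: "nat \<Rightarrow> 'c tm \<Rightarrow> 'c tm" where
  "lift n (Var i) = (if i < n then Var i else Var (Suc i))"
| "lift n (Const c) = Const c"
| "lift n (Y A) = Y A"
| "lift n (Lam A M) = Lam A (lift (Suc n) M)"
| "lift n (App M N) = App (lift n M) (lift n N)"

text \<open>\<open>subst M N n\<close> replaces index \<open>n\<close> by \<open>N\<close> in \<open>M\<close> and removes the binder of \<open>n\<close>.\<close>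

primrec subst :: "'c tm \<Rightarrow> 'c tm \<Rightarrow> nat \<Rightarrow> 'c tm" where
  "subst (Var i) N n = (if i < n then Var i else if i = n then N else Var (i - 1))"
| "subst (Const c) N n = Const c"
| "subst (Y A) N n = Y A"
| "subst (Lam A M) N n = Lam A (subst M (lift 0 N) (Suc n))"
| "subst (App M M') N n = App (subst M N n) (subst M' N n)"

inductive red :: "'c tm \<Rightarrow> 'c tm \<Rightarrow> bool" where
  beta: "red (App (Lam A M) N) (subst M N 0)"
| delta: "red (App (Y A) M) (App M (App (Y A) M))"
| "red M M' \<Longrightarrow> red (App M N) (App M' N)"
| "red N N' \<Longrightarrow> red (App M N) (App M N')"
| "red M M' \<Longrightarrow> red (Lam A M) (Lam A M')"


section \<open>Boehm trees\<close>

datatype 'c head = HVar nat | HConst 'c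

primrec head_tm :: "'c head \<Rightarrow> 'c tm" where
  "head_tm (HVar i) = Var i"
| "head_tm (HConst c) = Const c"

text \<open>\<open>BNode As h ts\<close> is a node labelled \<open>\<lambda>x\<^sub>1\<dots>x\<^sub>n. h\<close>, with \<open>As\<close> the types of the \<open>x\<^sub>i\<close>.\<close>

codatatype 'c btree = BOmega | BNode "ty list" "'c head" "'c btree list"

abbreviation hnf_tm :: "ty list \<Rightarrow> 'c head \<Rightarrow> 'c tm list \<Rightarrow> 'c tm" where
  "hnf_tm As h Ns \<equiv> foldr Lam As (foldl App (head_tm h) Ns)"

text \<open>A head normal form of \<open>M\<close>, if there is one. By confluence the resulting Boehm tree does not
  depend on which one is chosen.\<close>

definition hnf :: "'c tm \<Rightarrow> (ty list \<times> 'c head \<times> 'c tm list) option" where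
  "hnf M = (if \<exists>As h Ns. red\<^sup>*\<^sup>* M (hnf_tm As h Ns)
            then Some (SOME (As, h, Ns). red\<^sup>*\<^sup>* M (hnf_tm As h Ns))
            else None)"

primcorec BT :: "'c tm \<Rightarrow> 'c btree" where
  "BT M = (case hnf M of
             None \<Rightarrow> BOmega
           | Some r \<Rightarrow> BNode (fst r) (fst (snd r)) (map BT (snd (snd r))))"

text \<open>Nodes of a tree are addressed by paths from the root.\<close>

primrec subtree :: "'c btree \<Rightarrow> nat list \<Rightarrow> 'c btree option" where
  "subtree t [] = Some t"
| "subtree t (i # v) = (case t of
       BOmega \<Rightarrow> None
     | BNode As h ts \<Rightarrow> if i < length ts then subtree (ts ! i) v else None)"


section \<open>Alternating automata\<close>

record ('q, 'c) automaton =
  states :: "'q set"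
  signature :: "'c \<Rightarrow> ty option"
  init :: 'q
  delta0 :: "'q \<Rightarrow> 'c \<Rightarrow> unit set"
  delta2 :: "'q \<Rightarrow> 'c \<Rightarrow> ('q set \<times> 'q set) set"
  rank :: "'q \<Rightarrow> nat"

definition Q_le :: "('q, 'c) automaton \<Rightarrow> nat \<Rightarrow> 'q set" where
  "Q_le \<A> k = {q \<in> states \<A>. rank \<A> q \<le> k}"

definition max_rank :: "('q, 'c) automaton \<Rightarrow> nat" where
  "max_rank \<A> = Max (rank \<A> ` states \<A>)"

definition alternating_automaton :: "('q, 'c) automaton \<Rightarrow> bool" where
  "alternating_automaton \<A> \<longleftrightarrow>
     finite (states \<A>) \<and> init \<A> \<in> states \<A> \<and>
     ran (signature \<A>) \<subseteq> {\<o>, \<o> \<rightarrow> \<o> \<rightarrow> \<o>} \<and>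
     (\<forall>q \<in> states \<A>. \<forall>a. signature \<A> a = Some (\<o> \<rightarrow> \<o> \<rightarrow> \<o>) \<longrightarrow>
        delta2 \<A> q a \<subseteq> Pow (states \<A>) \<times> Pow (states \<A>))"

definition weak :: "('q, 'c) automaton \<Rightarrow> bool" where
  "weak \<A> \<longleftrightarrow>
     (\<forall>q \<in> states \<A>. \<forall>a. signature \<A> a = Some (\<o> \<rightarrow> \<o> \<rightarrow> \<o>) \<longrightarrow>
        (\<forall>(S0, S1) \<in> delta2 \<A> q a. S0 \<subseteq> Q_le \<A> (rank \<A> q) \<and> S1 \<subseteq> Q_le \<A> (rank \<A> q)))"

definition monotone_transitions :: "('q, 'c) automaton \<Rightarrow> bool" where
  "monotone_transitions \<A> \<longleftrightarrow>
     (\<forall>q \<in> states \<A>. \<forall>a. signature \<A> a = Some (\<o> \<rightarrow> \<o> \<rightarrow> \<o>) \<longrightarrow>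
        (\<forall>S0 S1 S0' S1'. (S0, S1) \<in> delta2 \<A> q a \<longrightarrow>
           S0 \<subseteq> S0' \<longrightarrow> S0' \<subseteq> Q_le \<A> (rank \<A> q) \<longrightarrow>
           S1 \<subseteq> S1' \<longrightarrow> S1' \<subseteq> Q_le \<A> (rank \<A> q) \<longrightarrow>
           (S0', S1') \<in> delta2 \<A> q a))"


section \<open>The acceptance game\<close>

text \<open>In \<open>EveAt v q\<close> the play is at node \<open>v\<close> in state \<open>q\<close>; in \<open>AdamAt v S0 S1\<close> it is at node \<open>v\<close>
  and Eve has just picked \<open>(S0, S1)\<close>.\<close>

datatype 'q position = EveAt "nat list" 'q | AdamAt "nat list" "'q set" "'q set"

inductive move :: "('q, 'c) automaton \<Rightarrow> 'c btree \<Rightarrow> 'q position \<Rightarrow> 'q position \<Rightarrow> bool"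
  for \<A> :: "('q, 'c) automaton" and t :: "'c btree" where
  "subtree t v = Some (BNode [] (HConst a) [t0, t1]) \<Longrightarrow> (S0, S1) \<in> delta2 \<A> q a \<Longrightarrow>
     move \<A> t (EveAt v q) (AdamAt v S0 S1)"
| "q' \<in> S0 \<Longrightarrow> move \<A> t (AdamAt v S0 S1) (EveAt (v @ [0]) q')"
| "q' \<in> S1 \<Longrightarrow> move \<A> t (AdamAt v S0 S1) (EveAt (v @ [1]) q')"

text \<open>Who wins a finite play, according to the position where it stopped. Leaves other than \<open>\<Omega>\<close>
  and constants do not occur in trees of closed terms of type \<open>\<o>\<close>.\<close>

fun eve_wins_stuck :: "('q, 'c) automaton \<Rightarrow> 'c btree \<Rightarrow> 'q position \<Rightarrow> bool" where
  "eve_wins_stuck \<A> t (EveAt v q) \<longleftrightarrow>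
     (\<exists>c. subtree t v = Some (BNode [] (HConst c) []) \<and> delta0 \<A> q c \<noteq> {}) \<or>
     (subtree t v = Some BOmega \<and> even (rank \<A> q))"
| "eve_wins_stuck \<A> t (AdamAt v S0 S1) \<longleftrightarrow> True"

text \<open>A strategy for Eve maps histories (nonempty, ending in a position of hers) to the next
  position. \<open>history \<A> t q \<sigma> h\<close>: \<open>h\<close> is a finite initial segment of a play from the root and \<open>q\<close>
  in which Eve follows \<open>\<sigma>\<close>.\<close>

inductive history ::
  "('q, 'c) automaton \<Rightarrow> 'c btree \<Rightarrow> 'q \<Rightarrow> ('q position list \<Rightarrow> 'q position) \<Rightarrow> 'q position list \<Rightarrow> bool"
  for \<A> :: "('q, 'c) automaton" and t :: "'c btree" and q :: 'q
    and \<sigma> :: "'q position list \<Rightarrow> 'q position" where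
  "history \<A> t q \<sigma> [EveAt [] q]"
| "history \<A> t q \<sigma> h \<Longrightarrow> last h = EveAt v r \<Longrightarrow> move \<A> t (EveAt v r) (\<sigma> h) \<Longrightarrow>
     history \<A> t q \<sigma> (h @ [\<sigma> h])"
| "history \<A> t q \<sigma> h \<Longrightarrow> last h = AdamAt v S0 S1 \<Longrightarrow> move \<A> t (AdamAt v S0 S1) p \<Longrightarrow>
     history \<A> t q \<sigma> (h @ [p])"

definition infinite_play ::
  "('q, 'c) automaton \<Rightarrow> 'c btree \<Rightarrow> 'q \<Rightarrow> ('q position list \<Rightarrow> 'q position) \<Rightarrow> (nat \<Rightarrow> 'q position) \<Rightarrow> bool" where
  "infinite_play \<A> t q \<sigma> \<pi> \<longleftrightarrow> (\<forall>n. history \<A> t q \<sigma> (map \<pi> [0..<Suc n]))"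

text \<open>The rank of a play is read off at the positions \<open>EveAt v r\<close>, which carry a state.\<close>

definition winning_strategy ::
  "('q, 'c) automaton \<Rightarrow> 'c btree \<Rightarrow> 'q \<Rightarrow> ('q position list \<Rightarrow> 'q position) \<Rightarrow> bool" where
  "winning_strategy \<A> t q \<sigma> \<longleftrightarrow>
     (\<forall>h v r. history \<A> t q \<sigma> h \<longrightarrow> last h = EveAt v r \<longrightarrow> (\<exists>p. move \<A> t (EveAt v r) p) \<longrightarrow>
        move \<A> t (EveAt v r) (\<sigma> h)) \<and>
     (\<forall>h. history \<A> t q \<sigma> h \<longrightarrow> (\<nexists>p. move \<A> t (last h) p) \<longrightarrow> eve_wins_stuck \<A> t (last h)) \<and>
     (\<forall>\<pi>. infinite_play \<A> t q \<sigma> \<pi> \<longrightarrow>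
        (\<exists>n k. even k \<and> (\<forall>i \<ge> n. \<forall>v r. \<pi> i = EveAt v r \<longrightarrow> rank \<A> r = k)))"

definition accepts :: "('q, 'c) automaton \<Rightarrow> 'c btree \<Rightarrow> 'q \<Rightarrow> bool" where
  "accepts \<A> t q \<longleftrightarrow> (\<exists>\<sigma>. winning_strategy \<A> t q \<sigma>)"

definition accepting_states :: "('q, 'c) automaton \<Rightarrow> 'c tm \<Rightarrow> 'q set" where
  "accepting_states \<A> M = {q \<in> states \<A>. accepts \<A> (BT M) q}"


section \<open>The stratified model\<close>

text \<open>All \<open>\<D>\<^sup>k\<^sub>A\<close> live in one type: an element of \<open>\<D>\<^sup>k\<^sub>\<o>\<close> is a \<open>VSet\<close>, an element of an arrow type is
  the graph \<open>VFun\<close> of a function, which is finite since the domains are.\<close>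

datatype 'q val = VSet (the_set: "'q set") | VFun (graph: "('q val \<times> 'q val) fset")

definition vapp :: "'q val \<Rightarrow> 'q val \<Rightarrow> 'q val" where
  "vapp f x = (THE y. (x, y) |\<in>| graph f)"

definition vlam :: "'q val set \<Rightarrow> ('q val \<Rightarrow> 'q val) \<Rightarrow> 'q val" where
  "vlam X f = VFun (Abs_fset ((\<lambda>x. (x, f x)) ` X))"

definition mono_maps ::
  "'q val set \<Rightarrow> ('q val \<Rightarrow> 'q val \<Rightarrow> bool) \<Rightarrow> 'q val set \<Rightarrow> ('q val \<Rightarrow> 'q val \<Rightarrow> bool) \<Rightarrow> 'q val set" where
  "mono_maps X leX Z leZ =
     {vlam X f | f. f ` X \<subseteq> Z \<and> (\<forall>x \<in> X. \<forall>y \<in> X. leX x y \<longrightarrow> leZ (f x) (f y))}"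

text \<open>\<open>Dom\<close>, \<open>Rel\<close> and \<open>leq\<close> are \<open>\<D>\<^sup>k\<^sub>A\<close>, \<open>\<L>\<^sup>k\<^sub>A\<close> and the order of \<open>\<D>\<^sup>k\<^sub>A\<close>. \<open>\<L>\<^sup>k\<^sub>A\<close> is only meaningful
  for \<open>k > 0\<close>.\<close>

function (sequential)
  Dom :: "('q, 'c) automaton \<Rightarrow> nat \<Rightarrow> ty \<Rightarrow> 'q val set" and
  Rel :: "('q, 'c) automaton \<Rightarrow> nat \<Rightarrow> ty \<Rightarrow> ('q val \<times> 'q val) set" and
  leq :: "('q, 'c) automaton \<Rightarrow> nat \<Rightarrow> ty \<Rightarrow> 'q val \<Rightarrow> 'q val \<Rightarrow> bool"
where
  "Dom \<A> k \<o> = VSet ` Pow (Q_le \<A> k)"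
| "Dom \<A> 0 (A \<rightarrow> B) = mono_maps (Dom \<A> 0 A) (leq \<A> 0 A) (Dom \<A> 0 B) (leq \<A> 0 B)"
| "Dom \<A> (Suc k) (A \<rightarrow> B) = {f2. \<exists>f1. (f1, f2) \<in> Rel \<A> (Suc k) (A \<rightarrow> B)}"
| "Rel \<A> 0 A = {}"
| "Rel \<A> (Suc k) \<o> =
     {(R, P). R \<in> Dom \<A> k \<o> \<and> P \<in> Dom \<A> (Suc k) \<o> \<and> the_set R = the_set P \<inter> Q_le \<A> k}"
| "Rel \<A> (Suc k) (A \<rightarrow> B) =
     {(f1, f2). f1 \<in> Dom \<A> k (A \<rightarrow> B) \<and>
        f2 \<in> mono_maps (Dom \<A> (Suc k) A) (leq \<A> (Suc k) A) (Dom \<A> (Suc k) B) (leq \<A> (Suc k) B) \<and>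
        (\<forall>(g1, g2) \<in> Rel \<A> (Suc k) A. (vapp f1 g1, vapp f2 g2) \<in> Rel \<A> (Suc k) B)}"
| "leq \<A> k \<o> = (\<lambda>x y. the_set x \<subseteq> the_set y)"
| "leq \<A> k (A \<rightarrow> B) = (\<lambda>f g. \<forall>x \<in> Dom \<A> k A. leq \<A> k B (vapp f x) (vapp g x))"
  by pat_completeness auto
termination
  by (relation "inv_image (less_than <*lex*> less_than <*lex*> less_than)
        (case_sum (\<lambda>(\<A>, k, A). (k, size A, if A = \<o> then 0 else 1))
          (case_sum (\<lambda>(\<A>, k, A). (k, size A, if A = \<o> then 1 else 0)) (\<lambda>(\<A>, k, A). (k, size A, 0))))") auto

definition is_greatest :: "('a \<Rightarrow> 'a \<Rightarrow> bool) \<Rightarrow> 'a set \<Rightarrow> 'a \<Rightarrow> bool" where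
  "is_greatest le X x \<longleftrightarrow> x \<in> X \<and> (\<forall>y \<in> X. le y x)"

definition is_least :: "('a \<Rightarrow> 'a \<Rightarrow> bool) \<Rightarrow> 'a set \<Rightarrow> 'a \<Rightarrow> bool" where
  "is_least le X x \<longleftrightarrow> x \<in> X \<and> (\<forall>y \<in> X. le x y)"

definition Top :: "('q, 'c) automaton \<Rightarrow> nat \<Rightarrow> ty \<Rightarrow> 'q val" where
  "Top \<A> k A = (THE e. is_greatest (leq \<A> k A) (Dom \<A> k A) e)"

definition Meet :: "('q, 'c) automaton \<Rightarrow> nat \<Rightarrow> ty \<Rightarrow> 'q val set \<Rightarrow> 'q val" where
  "Meet \<A> k A X =
     (THE e. is_greatest (leq \<A> k A) {d \<in> Dom \<A> k A. \<forall>x \<in> X. leq \<A> k A d x} e)"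

definition Join :: "('q, 'c) automaton \<Rightarrow> nat \<Rightarrow> ty \<Rightarrow> 'q val set \<Rightarrow> 'q val" where
  "Join \<A> k A X =
     (THE e. is_least (leq \<A> k A) {d \<in> Dom \<A> k A. \<forall>x \<in> X. leq \<A> k A x d} e)"

text \<open>\<open>e\<^sup>\<down>\<close> for \<open>e \<in> \<D>\<^sup>k\<^sub>A\<close>, and \<open>d\<^sup>\<up>\<^sup>\<top>\<close>, \<open>d\<^sup>\<up>\<^sup>\<bottom>\<close> in \<open>\<D>\<^sup>k\<^sub>A\<close>; in all three cases \<open>k > 0\<close> is the upper level.\<close>

definition down :: "('q, 'c) automaton \<Rightarrow> nat \<Rightarrow> ty \<Rightarrow> 'q val \<Rightarrow> 'q val" where
  "down \<A> k A e = (THE d. (d, e) \<in> Rel \<A> k A)"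

definition up_top :: "('q, 'c) automaton \<Rightarrow> nat \<Rightarrow> ty \<Rightarrow> 'q val \<Rightarrow> 'q val" where
  "up_top \<A> k A d = (THE e. is_greatest (leq \<A> k A) {e. (d, e) \<in> Rel \<A> k A} e)"

definition up_bot :: "('q, 'c) automaton \<Rightarrow> nat \<Rightarrow> ty \<Rightarrow> 'q val \<Rightarrow> 'q val" where
  "up_bot \<A> k A d = (THE e. is_least (leq \<A> k A) {e. (d, e) \<in> Rel \<A> k A} e)"

primrec fixp :: "('q, 'c) automaton \<Rightarrow> nat \<Rightarrow> ty \<Rightarrow> 'q val \<Rightarrow> 'q val" where
  "fixp \<A> 0 A f = Meet \<A> 0 A {(vapp f ^^ n) (Top \<A> 0 A) | n. True}"
| "fixp \<A> (Suc k) A f =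
     (let d = fixp \<A> k A (down \<A> (Suc k) (A \<rightarrow> A) f) in
      if even (Suc k)
      then Meet \<A> (Suc k) A {(vapp f ^^ n) (up_top \<A> (Suc k) A d) | n. True}
      else Join \<A> (Suc k) A {(vapp f ^^ n) (up_bot \<A> (Suc k) A d) | n. True})"

text \<open>\<open>S0\<close>, \<open>S1\<close> range over \<open>\<P>(Q\<^sub>\<le>\<^sub>k)\<close>, whereas a weak automaton has \<open>\<delta>(q,a) \<subseteq> \<P>(Q\<^sub>\<le>\<^sub>\<rho>\<^sub>(\<^sub>q\<^sub>))\<^sup>2\<close>. So
  \<open>(S0,S1) \<in> \<delta>(q,a)\<close> has to be read up to states of rank above \<open>\<rho>(q)\<close>, which are irrelevant to a run
  in state \<open>q\<close>. Without the intersections the map would be neither monotone nor related by \<open>\<L>\<^sup>k\<close> to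
  the interpretation at level \<open>k - 1\<close>, hence not an element of \<open>\<D>\<^sup>k\<close>.\<close>

definition const2 :: "('q, 'c) automaton \<Rightarrow> nat \<Rightarrow> 'c \<Rightarrow> 'q set \<Rightarrow> 'q set \<Rightarrow> 'q set" where
  "const2 \<A> k a S0 S1 =
     {q \<in> Q_le \<A> k. (S0 \<inter> Q_le \<A> (rank \<A> q), S1 \<inter> Q_le \<A> (rank \<A> q)) \<in> delta2 \<A> q a}"

definition const_interp :: "('q, 'c) automaton \<Rightarrow> nat \<Rightarrow> 'c \<Rightarrow> 'q val" where
  "const_interp \<A> k c =
     (if signature \<A> c = Some \<o> then VSet {q \<in> Q_le \<A> k. delta0 \<A> q c \<noteq> {}}
      else vlam (Dom \<A> k \<o>) (\<lambda>x. vlam (Dom \<A> k \<o>) (\<lambda>y.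
             VSet (const2 \<A> k c (the_set x) (the_set y)))))"

primrec interp :: "('q, 'c) automaton \<Rightarrow> nat \<Rightarrow> 'q val list \<Rightarrow> 'c tm \<Rightarrow> 'q val" where
  "interp \<A> k \<nu> (Var i) = \<nu> ! i"
| "interp \<A> k \<nu> (Const c) = const_interp \<A> k c"
| "interp \<A> k \<nu> (Y A) = vlam (Dom \<A> k (A \<rightarrow> A)) (fixp \<A> k A)"
| "interp \<A> k \<nu> (Lam A M) = vlam (Dom \<A> k A) (\<lambda>p. interp \<A> k (p # \<nu>) M)"
| "interp \<A> k \<nu> (App M N) = vapp (interp \<A> k \<nu> M) (interp \<A> k \<nu> N)"

end

theory Submission
  imports Defs
begin

text \<open>The acceptance game is solved rank by rank: once the winning region for ranks below \<open>k\<close> is known,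
  its part of rank \<open>k\<close> is a greatest fixpoint if \<open>k\<close> is even and a least one if \<open>k\<close> is odd. By induction
  on \<open>k\<close> the interpretation in \<open>\<D>\<^sup>k\<close> equals this region. One inclusion is (co)induction on that
  fixpoint, because the interpretation is invariant under reduction and hence satisfies the equations
  of the game at head normal forms, while terms without one are won by the right player at rank \<open>k\<close>.
  The other inclusion follows from a logical relation between closed terms and elements of \<open>\<D>\<^sup>k\<close>. For
  a fixpoint \<open>Y F\<close>, the iteration that defines \<open>fix\<^sup>k\<close> starts from the extremal element over the
  interpretation of \<open>Y F\<close> in \<open>\<D>\<^sup>k\<^sup>-\<^sup>1\<close>, which is related to \<open>Y F\<close> by the induction hypothesis, and each
  step of the iteration preserves the relation, as \<open>Y F\<close> and \<open>F (Y F)\<close> have the same Boehm tree.\<close>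

section \<open>Confluence\<close>

text \<open>Two features of the model carry the fixpoint case. Every domain is finite, so
  \<open>fixp\<close> is itself one of the iterates and the logical relation needs no closure under
  limits. And an extremal lift of a function inspects its argument only through the restriction to
  the level below, so the extremal element over the interpretation of M, applied to any element over
  that of N, is the extremal element over that of M N; at type o it errs only in rank k, always on
  the permitted side. Even k starts from greatest lifts, which can only be upper bounds, odd k from
  least lifts, which can only be lower bounds. This is why the relation yields one inclusion per
  parity and the other has to come from the layer: a greatest fixpoint contains whatever supports
  itself, a least one lies in whatever is closed. On the game side, weakness keeps ranks from
  rising, so a layer never affects the regions beneath it. Boehm trees are built from an arbitrarily
  chosen head normal form, which is why their invariance under reduction rests on
  confluence.\<close>

lemma lift_lift: "i \<le> n \<Longrightarrow> lift (Suc n) (lift i M) = lift i (lift n M)"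
  by (induction M arbitrary: i n) auto

lemma lift_subst: "j \<le> i \<Longrightarrow> lift i (subst M N j) = subst (lift (Suc i) M) (lift i N) j"
  by (induction M arbitrary: i j N) (auto simp: lift_lift)

lemma lift_subst_le: "i \<le> j \<Longrightarrow> lift i (subst M N j) = subst (lift i M) (lift i N) (Suc j)"
  by (induction M arbitrary: i j N) (auto simp: lift_lift)

lemma subst_lift [simp]: "subst (lift n M) N n = M"
  by (induction M arbitrary: n N) auto

text \<open>The substitution lemma in de Bruijn form. It turns the contractum of a substituted beta
  redex into the substituted contractum, the crucial case of \<open>par_subst\<close>.\<close>

lemma subst_subst:
  "i \<le> j \<Longrightarrow> subst (subst M (lift i P) (Suc j)) (subst N P j) i = subst (subst M N i) P j"
proof (induction M arbitrary: i j N P)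
  case (Lam A M)
  then show ?case
    using Lam.IH[of "Suc i" "Suc j" "lift 0 P" "lift 0 N"] by (simp add: lift_lift lift_subst_le)
qed auto

section \<open>Parallel reduction and its diamond property\<close>

inductive par :: "'c tm \<Rightarrow> 'c tm \<Rightarrow> bool" where
  par_Var: "par (Var i) (Var i)"
| par_Const: "par (Const c) (Const c)"
| par_Y: "par (Y A) (Y A)"
| par_Lam: "par M M' \<Longrightarrow> par (Lam A M) (Lam A M')"
| par_App: "par M M' \<Longrightarrow> par N N' \<Longrightarrow> par (App M N) (App M' N')"
| par_beta: "par M M' \<Longrightarrow> par N N' \<Longrightarrow> par (App (Lam A M) N) (subst M' N' 0)"
| par_delta: "par M M' \<Longrightarrow> par (App (Y A) M) (App M' (App (Y A) M'))"

lemma par_refl [simp]: "par M M"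
  by (induction M) (auto intro: par.intros)

lemma par_lift: "par M M' \<Longrightarrow> par (lift n M) (lift n M')"
  by (induction arbitrary: n rule: par.induct) (auto simp: lift_subst intro: par.intros)

lemma par_subst: "par M M' \<Longrightarrow> par N N' \<Longrightarrow> par (subst M N n) (subst M' N' n)"
proof (induction arbitrary: N N' n rule: par.induct)
  case (par_beta M M' P P' A)
  have "par (App (Lam A (subst M (lift 0 N) (Suc n))) (subst P N n))
          (subst (subst M' (lift 0 N') (Suc n)) (subst P' N' n) 0)"
    using par_beta by (intro par.par_beta) (auto intro: par_lift)
  then show ?case by (simp add: subst_subst)
next
  case (par_Lam M M' A)
  then show ?case by (simp add: par.par_Lam par_lift)
qed (auto intro: par.intros)

text \<open>Takahashi's complete development, which contracts all redexes present in the term at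
  once. The last clause is reached only if the function part is neither an abstraction nor some
  \<open>Y A\<close>.\<close>

fun development :: "'c tm \<Rightarrow> 'c tm" where
  "development (Var i) = Var i"
| "development (Const c) = Const c"
| "development (Y A) = Y A"
| "development (Lam A M) = Lam A (development M)"
| "development (App (Lam A M) N) = subst (development M) (development N) 0"
| "development (App (Y A) M) = App (development M) (App (Y A) (development M))"
| "development (App M N) = App (development M) (development N)"

inductive_cases par_LamE: "par (Lam A M) N"
inductive_cases par_YE: "par (Y A) N"

text \<open>The triangle property: the target depends on \<open>M\<close> alone, so any two parallel
  reducts of \<open>M\<close> meet there after one further step.\<close>

lemma par_development: "par M N \<Longrightarrow> par N (development M)"
proof (induction rule: par.induct)
  case (par_App M M' N N')
  show ?case
  proof (cases M)
    \<comment> \<open>\<open>development\<close> branches on the function part, and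
      \<open>par\<close> keeps it an abstraction or a \<open>Y A\<close>, so a redex at the root
      survives in the reduct.\<close>
    case (Lam A P)
    from par_App.hyps(1) obtain P' where P': "M' = Lam A P'"
      unfolding Lam by (blast elim: par_LamE)
    from par_App.IH(1) have "par P' (development P)"
      unfolding Lam P' by (auto elim: par_LamE)
    with par_App.IH show ?thesis by (simp add: Lam P' par_beta)
  next
    case (Y A)
    with par_App.hyps(1) have "M' = tm.Y A" by (blast elim: par_YE)
    with par_App.IH Y show ?thesis by (simp add: par_delta)
  qed (use par_App.IH in \<open>auto intro: par.intros\<close>)
qed (auto intro: par.intros par_subst)

lemma red_imp_par: "red M N \<Longrightarrow> par M N"
  by (induction rule: red.induct) (auto intro: par.intros)

lemma reds_App: "red\<^sup>*\<^sup>* M M' \<Longrightarrow> red\<^sup>*\<^sup>* N N' \<Longrightarrow> red\<^sup>*\<^sup>* (App M N) (App M' N')"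
proof -
  assume M: "red\<^sup>*\<^sup>* M M'" and N: "red\<^sup>*\<^sup>* N N'"
  from M have "red\<^sup>*\<^sup>* (App M N) (App M' N)"
    by induction (auto intro: red.intros rtranclp.rtrancl_into_rtrancl)
  also from N have "red\<^sup>*\<^sup>* (App M' N) (App M' N')"
    by induction (auto intro: red.intros rtranclp.rtrancl_into_rtrancl)
  finally show ?thesis .
qed

lemma reds_Lam: "red\<^sup>*\<^sup>* M M' \<Longrightarrow> red\<^sup>*\<^sup>* (Lam A M) (Lam A M')"
  by (induction rule: rtranclp_induct) (auto intro: red.intros rtranclp.rtrancl_into_rtrancl)

lemma par_imp_reds: "par M N \<Longrightarrow> red\<^sup>*\<^sup>* M N"
proof (induction rule: par.induct)
  case (par_beta M M' N N' A)
  have "red\<^sup>*\<^sup>* (App (Lam A M) N) (App (Lam A M') N')"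
    using par_beta by (intro reds_App reds_Lam)
  then show ?case by (meson red.beta rtranclp.rtrancl_into_rtrancl)
next
  case (par_delta M M' A)
  have "red\<^sup>*\<^sup>* (App (Y A) M) (App (Y A) M')"
    using par_delta by (intro reds_App) auto
  then show ?case by (meson red.delta rtranclp.rtrancl_into_rtrancl)
qed (auto intro: reds_App reds_Lam)

lemma reds_eq_pars: "red\<^sup>*\<^sup>* = par\<^sup>*\<^sup>*"
  by (rule rtranclp_subset[symmetric]) (auto intro: red_imp_par par_imp_reds)

text \<open>One parallel step is pushed along the other sequence; each new meeting point is the
  complete development of the term left behind.\<close>

lemma pars_strip: "par\<^sup>*\<^sup>* M M' \<Longrightarrow> par M N \<Longrightarrow> \<exists>Z. par M' Z \<and> par\<^sup>*\<^sup>* N Z"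
proof (induction rule: rtranclp_induct)
  case (step M1 M2)
  then obtain Z where "par M1 Z" "par\<^sup>*\<^sup>* N Z" by blast
  with step.hyps show ?case
    by (meson par_development rtranclp.rtrancl_into_rtrancl)
qed auto

definition joinable :: "'c tm \<Rightarrow> 'c tm \<Rightarrow> bool" where
  "joinable M N \<longleftrightarrow> (\<exists>Z. red\<^sup>*\<^sup>* M Z \<and> red\<^sup>*\<^sup>* N Z)"

lemma confluence: "red\<^sup>*\<^sup>* M N \<Longrightarrow> red\<^sup>*\<^sup>* M N' \<Longrightarrow> joinable N N'"
  unfolding joinable_def reds_eq_pars
proof (induction rule: rtranclp_induct)
  case (step N1 N2)
  then obtain Z where "par\<^sup>*\<^sup>* N1 Z" "par\<^sup>*\<^sup>* N' Z" by blast
  with step.hyps show ?case using pars_strip by (meson rtranclp.rtrancl_into_rtrancl)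
qed auto

section \<open>Boehm trees are invariant under reduction\<close>

lemma foldl_App_neq [simp]:
  "foldl App (head_tm h) Ns \<noteq> Lam A M" "foldl App (head_tm h) Ns \<noteq> Y A"
  "Lam A M \<noteq> foldl App (head_tm h) Ns" "Y A \<noteq> foldl App (head_tm h) Ns"
  by (cases h; cases Ns rule: rev_cases; simp)+

lemma foldl_App_inject:
  "foldl App (head_tm h) Ns = foldl App (head_tm h') Ns' \<Longrightarrow> h = h' \<and> Ns = Ns'"
proof (induction Ns arbitrary: Ns' rule: rev_induct)
  case Nil
  then show ?case by (cases h; cases h'; cases Ns' rule: rev_cases) auto
next
  case (snoc N Ns)
  then show ?case by (cases h'; cases Ns' rule: rev_cases) auto
qed

lemma hnf_tm_inject:
  "hnf_tm As h Ns = hnf_tm As' h' Ns' \<Longrightarrow> As = As' \<and> h = h' \<and> Ns = Ns'"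
proof (induction As arbitrary: As')
  case Nil
  then show ?case by (cases As') (auto dest: foldl_App_inject)
next
  case (Cons A As)
  then show ?case by (cases As') auto
qed

text \<open>The head of a spine is a variable or a constant, so no prefix of the spine is a redex
  and reduction stays inside the arguments.\<close>

lemma red_foldl_App:
  "red (foldl App (head_tm h) Ns) Z \<Longrightarrow>
     \<exists>Ns'. Z = foldl App (head_tm h) Ns' \<and> list_all2 red\<^sup>*\<^sup>* Ns Ns'"
proof (induction Ns arbitrary: Z rule: rev_induct)
  case Nil
  then show ?case by (cases h) (auto elim: red.cases)
next
  case (snoc N Ns)
  from snoc.prems have "red (App (foldl App (head_tm h) Ns) N) Z" by simp
  then consider M' where "Z = App M' N" "red (foldl App (head_tm h) Ns) M'"
    | N' where "Z = App (foldl App (head_tm h) Ns) N'" "red N N'"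
    by (cases rule: red.cases) auto
  then show ?case
  proof cases
    case (1 M')
    with snoc.IH obtain Ns' where "M' = foldl App (head_tm h) Ns'" "list_all2 red\<^sup>*\<^sup>* Ns Ns'"
      by blast
    with 1 show ?thesis
      by (intro exI[of _ "Ns' @ [N]"]) (auto intro: list_all2_appendI)
  next
    case (2 N')
    then show ?thesis
      by (intro exI[of _ "Ns @ [N']"]) (auto intro!: list_all2_appendI simp: list_all2_same)
  qed
qed

lemma red_hnf_tm:
  "red (hnf_tm As h Ns) Z \<Longrightarrow> \<exists>Ns'. Z = hnf_tm As h Ns' \<and> list_all2 red\<^sup>*\<^sup>* Ns Ns'"
proof (induction As arbitrary: Z)
  case Nil
  then show ?case using red_foldl_App by simp
next
  case (Cons A As)
  from Cons.prems have "red (Lam A (hnf_tm As h Ns)) Z" by simp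
  then show ?case by (cases rule: red.cases) (use Cons.IH in auto)
qed

lemma reds_hnf_tm:
  "red\<^sup>*\<^sup>* (hnf_tm As h Ns) Z \<Longrightarrow> \<exists>Ns'. Z = hnf_tm As h Ns' \<and> list_all2 red\<^sup>*\<^sup>* Ns Ns'"
proof (induction rule: rtranclp_induct)
  case base
  show ?case by (auto simp: list_all2_same)
next
  case (step Z1 Z2)
  then obtain Ns1 Ns2 where "Z2 = hnf_tm As h Ns2" "list_all2 red\<^sup>*\<^sup>* Ns Ns1" "list_all2 red\<^sup>*\<^sup>* Ns1 Ns2"
    using red_hnf_tm by blast
  then show ?case
    using list_all2_trans[of "red\<^sup>*\<^sup>*" "red\<^sup>*\<^sup>*" "red\<^sup>*\<^sup>*" Ns Ns1 Ns2] rtranclp_trans[of red] by blast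
qed

lemma hnf_SomeD: "hnf M = Some (As, h, Ns) \<Longrightarrow> red\<^sup>*\<^sup>* M (hnf_tm As h Ns)"
proof -
  assume *: "hnf M = Some (As, h, Ns)"
  let ?P = "\<lambda>(As, h, Ns). red\<^sup>*\<^sup>* M (hnf_tm As h Ns)"
  from * have "\<exists>x. ?P x" and "(SOME x. ?P x) = (As, h, Ns)"
    by (auto simp: hnf_def split: if_splits)
  then show ?thesis using someI_ex[of ?P] by simp
qed

lemma hnf_ex: "red\<^sup>*\<^sup>* M (hnf_tm As h Ns) \<Longrightarrow> hnf M \<noteq> None"
  unfolding hnf_def by (metis option.distinct(1))

text \<open>\<open>hnf\<close> makes an arbitrary choice, so even for a term and its reduct the
  chosen arguments need not reduce to one another. Joinability is what survives, because every
  reduct of a head normal form keeps its binders and its head.\<close>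

lemma joinable_hnf:
  assumes "joinable M M'" "hnf M = Some (As, h, Ns)"
  shows "\<exists>Ns'. hnf M' = Some (As, h, Ns') \<and> list_all2 joinable Ns Ns'"
proof -
  obtain Z where Z: "red\<^sup>*\<^sup>* M Z" "red\<^sup>*\<^sup>* M' Z" using assms(1) by (auto simp: joinable_def)
  obtain W where W: "red\<^sup>*\<^sup>* (hnf_tm As h Ns) W" "red\<^sup>*\<^sup>* Z W"
    using confluence[OF hnf_SomeD[OF assms(2)] Z(1)] by (auto simp: joinable_def)
  obtain Ns1 where Ns1: "W = hnf_tm As h Ns1" "list_all2 red\<^sup>*\<^sup>* Ns Ns1"
    using reds_hnf_tm[OF W(1)] by blast
  have M'W: "red\<^sup>*\<^sup>* M' W" using Z W by simp
  then obtain As' h' Ns' where h': "hnf M' = Some (As', h', Ns')"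
    using hnf_ex Ns1(1) by fastforce
  obtain V where V: "red\<^sup>*\<^sup>* W V" "red\<^sup>*\<^sup>* (hnf_tm As' h' Ns') V"
    using confluence[OF M'W hnf_SomeD[OF h']] by (auto simp: joinable_def)
  obtain Ns2 where Ns2: "V = hnf_tm As h Ns2" "list_all2 red\<^sup>*\<^sup>* Ns1 Ns2"
    using reds_hnf_tm V(1) Ns1(1) by blast
  obtain Ns3 where Ns3: "V = hnf_tm As' h' Ns3" "list_all2 red\<^sup>*\<^sup>* Ns' Ns3"
    using reds_hnf_tm V(2) by blast
  have eq: "As = As' \<and> h = h' \<and> Ns2 = Ns3"
    using hnf_tm_inject Ns2(1) Ns3(1) by metis
  have "list_all2 joinable Ns Ns'"
    using Ns1(2) Ns2(2) Ns3(2) eq unfolding list_all2_conv_all_nth joinable_def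
    by (metis rtranclp_trans)
  with h' eq show ?thesis by blast
qed

lemma joinable_sym: "joinable M N \<Longrightarrow> joinable N M"
  by (auto simp: joinable_def)

lemma BT_None: "hnf M = None \<Longrightarrow> BT M = BOmega"
  by (subst BT.code) simp

lemma BT_Some: "hnf M = Some (As, h, Ns) \<Longrightarrow> BT M = BNode As h (map BT Ns)"
  by (subst BT.code) simp

text \<open>By \<open>joinable_hnf\<close>, joinability is a bisimulation on the generated trees; by
  symmetry it also covers the case without a head normal form.\<close>

lemma joinable_BT: "joinable M M' \<Longrightarrow> BT M = BT M'"
proof (coinduction arbitrary: M M' rule: btree.coinduct)
  case (Eq_btree M M')
  show ?case
  proof (cases "hnf M")
    case None
    with joinable_hnf[OF joinable_sym[OF Eq_btree]] have "hnf M' = None"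
      by (cases "hnf M'") auto
    with None show ?thesis by (simp add: BT_None)
  next
    case (Some r)
    obtain As h Ns where r: "r = (As, h, Ns)" by (cases r)
    with joinable_hnf[OF Eq_btree] Some obtain Ns' where
      "hnf M' = Some (As, h, Ns')" "list_all2 joinable Ns Ns'" by blast
    with Some r show ?thesis
      by (auto simp: BT_Some list_all2_conv_all_nth; blast)
  qed
qed

lemma reds_BT: "red\<^sup>*\<^sup>* M M' \<Longrightarrow> BT M = BT M'"
  by (rule joinable_BT) (auto simp: joinable_def)

text \<open>\<open>hnf\<close> may return another presentation than the given one, but its arguments
  are then reducts of \<open>Ns\<close> and have the same trees.\<close>

lemma BT_hnf_tm: "BT (hnf_tm As h Ns) = BNode As h (map BT Ns)"
proof -
  obtain As' h' Ns' where *: "hnf (hnf_tm As h Ns) = Some (As', h', Ns')"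
    using hnf_ex[of "hnf_tm As h Ns" As h Ns] by auto
  from reds_hnf_tm[OF hnf_SomeD[OF this]] have "As' = As \<and> h' = h \<and> list_all2 red\<^sup>*\<^sup>* Ns Ns'"
    using hnf_tm_inject by metis
  with * show ?thesis
    by (auto simp: BT_Some list_all2_conv_all_nth intro!: nth_equalityI reds_BT[symmetric])
qed

section \<open>Typing\<close>

inductive_cases has_type_VarE: "has_type \<Sigma> \<Gamma> (Var i) A"
inductive_cases has_type_ConstE: "has_type \<Sigma> \<Gamma> (Const c) A"
inductive_cases has_type_YE: "has_type \<Sigma> \<Gamma> (Y B) A"
inductive_cases has_type_LamE: "has_type \<Sigma> \<Gamma> (Lam B M) A"
inductive_cases has_type_AppE: "has_type \<Sigma> \<Gamma> (App M N) A"

lemma has_type_lift: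
  "has_type \<Sigma> (\<Gamma> @ \<Delta>) M A \<Longrightarrow> has_type \<Sigma> (\<Gamma> @ B # \<Delta>) (lift (length \<Gamma>) M) A"
proof (induction "\<Gamma> @ \<Delta>" M A arbitrary: \<Gamma> rule: has_type.induct)
  case (1 i)
  show ?case
  proof (cases "i < length \<Gamma>")
    case True
    then show ?thesis using has_type.intros(1)[of i "\<Gamma> @ B # \<Delta>" \<Sigma>] by (simp add: nth_append)
  next
    case False
    then show ?thesis using 1 has_type.intros(1)[of "Suc i" "\<Gamma> @ B # \<Delta>" \<Sigma>]
      by (simp add: nth_append Suc_diff_le)
  qed
next
  case (4 A M B')
  then show ?case using 4(2)[of "A # \<Gamma>"] by (auto intro: has_type.intros)
qed (auto intro: has_type.intros)

lemma has_type_subst: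
  "has_type \<Sigma> (\<Gamma> @ B # \<Delta>) M A \<Longrightarrow> has_type \<Sigma> (\<Gamma> @ \<Delta>) N B \<Longrightarrow>
     has_type \<Sigma> (\<Gamma> @ \<Delta>) (subst M N (length \<Gamma>)) A"
proof (induction "\<Gamma> @ B # \<Delta>" M A arbitrary: \<Gamma> N rule: has_type.induct)
  case (1 i)
  consider "i < length \<Gamma>" | "i = length \<Gamma>" | "i > length \<Gamma>" by linarith
  then show ?case
  proof cases
    case 1
    then show ?thesis using has_type.intros(1)[of i "\<Gamma> @ \<Delta>" \<Sigma>] by (simp add: nth_append)
  next
    case 2
    then show ?thesis using 1 by (simp add: nth_append)
  next
    case 3
    moreover from 3 have "(\<Gamma> @ \<Delta>) ! (i - 1) = (\<Gamma> @ B # \<Delta>) ! i"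
      by (auto simp: nth_append nth_Cons split: nat.splits)
        (metis Suc_diff_Suc diff_Suc_1' diff_Suc_eq_diff_pred nat.inject)
    ultimately show ?thesis using 1(1) has_type.intros(1)[of "i - 1" "\<Gamma> @ \<Delta>" \<Sigma>] by simp
  qed
next
  case (4 A M B')
  then show ?case
    using 4(2)[of "A # \<Gamma>" "lift 0 N"] has_type_lift[of \<Sigma> "[]" "\<Gamma> @ \<Delta>" N B A]
    by (auto intro: has_type.intros)
qed (auto intro: has_type.intros)

lemma has_type_red: "red M M' \<Longrightarrow> has_type \<Sigma> \<Gamma> M A \<Longrightarrow> has_type \<Sigma> \<Gamma> M' A"
proof (induction arbitrary: \<Gamma> A rule: red.induct)
  case (beta B M N)
  then show ?case
    using has_type_subst[of \<Sigma> "[]" B \<Gamma> M A N]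
    by (auto elim!: has_type_AppE has_type_LamE)
qed (auto elim!: has_type_AppE has_type_LamE has_type_YE intro: has_type.intros)

lemma has_type_reds: "red\<^sup>*\<^sup>* M M' \<Longrightarrow> has_type \<Sigma> \<Gamma> M A \<Longrightarrow> has_type \<Sigma> \<Gamma> M' A"
  by (induction rule: rtranclp_induct) (auto intro: has_type_red)

lemma has_type_weaken: "has_type \<Sigma> \<Gamma> M A \<Longrightarrow> has_type \<Sigma> (\<Gamma> @ \<Delta>) M A"
proof (induction rule: has_type.induct)
  case (1 i \<Gamma>)
  then show ?case using has_type.intros(1)[of i "\<Gamma> @ \<Delta>" \<Sigma>] by (simp add: nth_append)
qed (auto intro: has_type.intros)

lemma lift_closed: "has_type \<Sigma> \<Gamma> M A \<Longrightarrow> length \<Gamma> \<le> n \<Longrightarrow> lift n M = M"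
  by (induction arbitrary: n rule: has_type.induct) auto

lemma subst_closed: "has_type \<Sigma> \<Gamma> M A \<Longrightarrow> length \<Gamma> \<le> n \<Longrightarrow> subst M N n = M"
  by (induction arbitrary: n N rule: has_type.induct) auto

text \<open>Simultaneous substitution of closed terms; they need no lifting under binders.\<close>

primrec csubst :: "nat \<Rightarrow> 'c tm list \<Rightarrow> 'c tm \<Rightarrow> 'c tm" where
  "csubst n Ns (Var i) = (if i < n then Var i else Ns ! (i - n))"
| "csubst n Ns (Const c) = Const c"
| "csubst n Ns (Y A) = Y A"
| "csubst n Ns (Lam A M) = Lam A (csubst (Suc n) Ns M)"
| "csubst n Ns (App M N) = App (csubst n Ns M) (csubst n Ns N)"

lemma has_type_csubst:
  assumes "has_type \<Sigma> (\<Gamma> @ \<Delta>) M A" "list_all2 (has_type \<Sigma> []) Ns \<Delta>"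
  shows "has_type \<Sigma> \<Gamma> (csubst (length \<Gamma>) Ns M) A"
  using assms
proof (induction "\<Gamma> @ \<Delta>" M A arbitrary: \<Gamma> rule: has_type.induct)
  case (1 i)
  show ?case
  proof (cases "i < length \<Gamma>")
    case True
    then show ?thesis using has_type.intros(1)[of i \<Gamma> \<Sigma>] by (simp add: nth_append)
  next
    case False
    with 1 have "has_type \<Sigma> [] (Ns ! (i - length \<Gamma>)) (\<Delta> ! (i - length \<Gamma>))"
      by (auto simp: list_all2_conv_all_nth)
    from has_type_weaken[OF this, of \<Gamma>] False show ?thesis by (simp add: nth_append)
  qed
next
  case (4 A M B')
  then show ?case using 4(2)[of "A # \<Gamma>"] by (auto intro: has_type.intros)
qed (auto intro: has_type.intros)

text \<open>Identifies the contractum of a beta redex in the abstraction case of the fundamental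
  lemma. The terms \<open>Ns\<close> are closed, hence untouched by the outer substitution.\<close>

lemma subst_csubst:
  assumes "has_type \<Sigma> (\<Gamma> @ B # \<Delta>) M A" "list_all2 (has_type \<Sigma> []) Ns \<Delta>" "has_type \<Sigma> [] N B"
  shows "subst (csubst (Suc (length \<Gamma>)) Ns M) N (length \<Gamma>) = csubst (length \<Gamma>) (N # Ns) M"
  using assms
proof (induction "\<Gamma> @ B # \<Delta>" M A arbitrary: \<Gamma> rule: has_type.induct)
  case (1 i)
  show ?case
  proof (cases "i \<le> length \<Gamma>")
    case False
    with 1 have "has_type \<Sigma> [] (Ns ! (i - Suc (length \<Gamma>))) (\<Delta> ! (i - Suc (length \<Gamma>)))"
      by (auto simp: list_all2_conv_all_nth)
    with False show ?thesis by (auto simp: subst_closed nth_Cons')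
  qed auto
next
  case (4 A M B')
  then show ?case using 4(2)[of "A # \<Gamma>"] by (simp add: lift_closed)
qed auto

lemma csubst_Nil: "has_type \<Sigma> \<Gamma> M A \<Longrightarrow> csubst (length \<Gamma>) [] M = M"
  by (induction rule: has_type.induct) auto

text \<open>Closedness excludes a variable as head, and at type o the head constant must have
  received all its arguments, of which the signature allows none or two.\<close>

lemma hnf_closed_base:
  assumes "has_type \<Sigma> [] M \<o>" "ran \<Sigma> \<subseteq> {\<o>, \<o> \<rightarrow> \<o> \<rightarrow> \<o>}" "hnf M = Some (As, h, Ns)"
  shows "As = [] \<and> (\<exists>c. h = HConst c \<and>
    (\<Sigma> c = Some \<o> \<and> Ns = [] \<or>
     \<Sigma> c = Some (\<o> \<rightarrow> \<o> \<rightarrow> \<o>) \<and> (\<exists>N0 N1. Ns = [N0, N1] \<and> has_type \<Sigma> [] N0 \<o> \<and> has_type \<Sigma> [] N1 \<o>)))"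
proof -
  have ty: "has_type \<Sigma> [] (hnf_tm As h Ns) \<o>"
    using has_type_reds[OF hnf_SomeD[OF assms(3)] assms(1)] .
  then have [simp]: "As = []" by (cases As) (auto elim: has_type_LamE)
  \<comment> \<open>The result type is generalized to \<open>A\<close> because peeling off arguments
    from the right passes through partial applications.\<close>
  have spine: "\<exists>c. h = HConst c \<and> (A = \<o> \<and> \<Sigma> c = Some \<o> \<and> Ns = [] \<or> \<Sigma> c = Some (\<o> \<rightarrow> \<o> \<rightarrow> \<o>) \<and>
      (A = (\<o> \<rightarrow> \<o> \<rightarrow> \<o>) \<and> Ns = [] \<or>
       A = (\<o> \<rightarrow> \<o>) \<and> (\<exists>N0. Ns = [N0] \<and> has_type \<Sigma> [] N0 \<o>) \<or>
       A = \<o> \<and> (\<exists>N0 N1. Ns = [N0, N1] \<and> has_type \<Sigma> [] N0 \<o> \<and> has_type \<Sigma> [] N1 \<o>)))"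
    if "has_type \<Sigma> [] (foldl App (head_tm h) Ns) A" for A
    using that
  proof (induction Ns arbitrary: A rule: rev_induct)
    case Nil
    then show ?case using assms(2)
      by (cases h) (auto elim!: has_type_VarE has_type_ConstE simp: ran_def)
  next
    case (snoc N Ns)
    from snoc.prems obtain B where B: "has_type \<Sigma> [] (foldl App (head_tm h) Ns) (B \<rightarrow> A)"
        "has_type \<Sigma> [] N B"
      by (auto elim: has_type_AppE)
    from snoc.IH[OF B(1)] B(2) show ?case by auto
  qed
  from spine[of \<o>] ty show ?thesis by auto
qed

section \<open>Finite monotone maps\<close>

lemma vapp_vlam [simp]: "finite X \<Longrightarrow> x \<in> X \<Longrightarrow> vapp (vlam X f) x = f x"
  unfolding vapp_def vlam_def by (auto simp: Abs_fset_inverse)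

lemma vlam_cong: "(\<And>x. x \<in> X \<Longrightarrow> f x = g x) \<Longrightarrow> vlam X f = vlam X g"
  unfolding vlam_def by (simp cong: image_cong)

lemma vlam_in_mono_maps:
  "(\<And>x. x \<in> X \<Longrightarrow> f x \<in> Z) \<Longrightarrow>
   (\<And>x y. x \<in> X \<Longrightarrow> y \<in> X \<Longrightarrow> leX x y \<Longrightarrow> leZ (f x) (f y)) \<Longrightarrow> vlam X f \<in> mono_maps X leX Z leZ"
  unfolding mono_maps_def by blast

text \<open>A graph records nothing beyond the values on \<open>X\<close>, so extensionally equal
  elements are equal. Antisymmetry at arrow types rests on this, and with it the uniqueness of
  greatest and least elements.\<close>

lemma mono_maps_eta: "finite X \<Longrightarrow> f \<in> mono_maps X leX Z leZ \<Longrightarrow> f = vlam X (vapp f)"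
  unfolding mono_maps_def by (auto intro!: vlam_cong)

lemma mono_maps_app: "finite X \<Longrightarrow> f \<in> mono_maps X leX Z leZ \<Longrightarrow> x \<in> X \<Longrightarrow> vapp f x \<in> Z"
  unfolding mono_maps_def by auto

lemma mono_maps_mono:
  "finite X \<Longrightarrow> f \<in> mono_maps X leX Z leZ \<Longrightarrow> x \<in> X \<Longrightarrow> y \<in> X \<Longrightarrow> leX x y \<Longrightarrow> leZ (vapp f x) (vapp f y)"
  unfolding mono_maps_def by auto

lemma finite_mono_maps: "finite X \<Longrightarrow> finite Z \<Longrightarrow> finite (mono_maps X leX Z leZ)"
proof (rule finite_subset)
  show "mono_maps X leX Z leZ \<subseteq> (\<lambda>G. VFun (Abs_fset G)) ` Pow (X \<times> Z)"
    unfolding mono_maps_def vlam_def by auto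
qed auto

text \<open>A sequence in a finite set repeats, and a descending one is constant from a repetition
  on. The order \<open>r\<close> is arbitrary so that the converse order covers ascending
  iterates.\<close>

lemma descending_iterates_stabilize:
  assumes "finite X" and trans: "\<And>x y z. x \<in> X \<Longrightarrow> y \<in> X \<Longrightarrow> z \<in> X \<Longrightarrow> r x y \<Longrightarrow> r y z \<Longrightarrow> r x z"
    and antisym: "\<And>x y. x \<in> X \<Longrightarrow> y \<in> X \<Longrightarrow> r x y \<Longrightarrow> r y x \<Longrightarrow> x = y"
    and refl: "\<And>x. x \<in> X \<Longrightarrow> r x x"
    and closed: "\<And>x. x \<in> X \<Longrightarrow> F x \<in> X"
    and mono: "\<And>x y. x \<in> X \<Longrightarrow> y \<in> X \<Longrightarrow> r x y \<Longrightarrow> r (F x) (F y)"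
    and e: "e \<in> X" "r (F e) e"
  shows "\<exists>n. F ((F ^^ n) e) = (F ^^ n) e \<and> (\<forall>m. r ((F ^^ n) e) ((F ^^ m) e))"
proof -
  let ?s = "\<lambda>n. (F ^^ n) e"
  have in_X: "?s n \<in> X" for n by (induction n) (auto simp: closed e)
  have step: "r (?s (Suc n)) (?s n)" for n
    by (induction n) (use in_X in \<open>auto simp: e closed intro!: mono\<close>)
  have anti: "r (?s (n + d)) (?s n)" for n d
  proof (induction d)
    case 0
    then show ?case by (simp add: refl in_X)
  next
    case (Suc d)
    then show ?case using trans[OF in_X in_X in_X step[of "n + d"]] by simp
  qed
  have "\<not> inj ?s"
    using finite_subset[of "range ?s" X] \<open>finite X\<close> in_X finite_imageD[of ?s UNIV] infinite_UNIV_nat by blast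
  then obtain i j where "i < j" and "?s i = ?s j"
    unfolding inj_def by (metis nat_neq_iff)
  \<comment> \<open>As \<open>?s j = ?s i\<close>, the element \<open>?s (Suc i)\<close> lies
    between two equal ones.\<close>
  then have "r (?s i) (?s (Suc i))"
    using anti[of "Suc i" "j - Suc i"] by simp
  with step[of i] have stable: "?s (Suc i) = ?s i"
    using antisym in_X by blast
  have const: "?s (i + d) = ?s i" for d
    by (induction d) (use stable in auto)
  have "r (?s i) (?s m)" for m
  proof (cases "m \<le> i")
    case True
    then show ?thesis using anti[of m "i - m"] by simp
  next
    case False
    then show ?thesis using const[of "m - i"] refl[OF in_X, of i] by simp
  qed
  with stable show ?thesis by auto
qed

section \<open>The stratified domains\<close>

locale weak_automaton =
  fixes \<A> :: "('q, 'c) automaton"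
  assumes alternating: "alternating_automaton \<A>"
    and weak: "weak \<A>"
    and monotone: "monotone_transitions \<A>"
begin

abbreviation "Qle \<equiv> Q_le \<A>"
abbreviation "D \<equiv> Dom \<A>"
abbreviation "L k \<equiv> Rel \<A> (Suc k)"
abbreviation "le \<equiv> leq \<A>"
abbreviation "typed \<equiv> has_type (signature \<A>)"

lemma finite_Qle [simp]: "finite (Qle k)"
  using alternating by (simp add: Q_le_def alternating_automaton_def)

lemma Qle_mono: "j \<le> k \<Longrightarrow> Qle j \<subseteq> Qle k"
  by (auto simp: Q_le_def)

lemma signature_cases:
  assumes "signature \<A> c = Some A"
  obtains "A = \<o>" | "A = (\<o> \<rightarrow> \<o> \<rightarrow> \<o>)"
  using assms alternating ranI[of "signature \<A>" c A] by (auto simp: alternating_automaton_def)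

lemma D_arrow: "f \<in> D k (A \<rightarrow> B) \<Longrightarrow> f \<in> mono_maps (D k A) (le k A) (D k B) (le k B)"
  by (cases k) auto

lemma finite_D [simp]: "finite (D k A)"
proof (induction A)
  case (Arr A B)
  then have "finite (mono_maps (D k A) (le k A) (D k B) (le k B))" by (rule finite_mono_maps)
  then show ?case by (rule finite_subset[rotated]) (use D_arrow in blast)
qed simp

lemma D_app: "f \<in> D k (A \<rightarrow> B) \<Longrightarrow> x \<in> D k A \<Longrightarrow> vapp f x \<in> D k B"
  using mono_maps_app[OF finite_D D_arrow] .

lemma D_mono:
  "f \<in> D k (A \<rightarrow> B) \<Longrightarrow> x \<in> D k A \<Longrightarrow> y \<in> D k A \<Longrightarrow> le k A x y \<Longrightarrow> le k B (vapp f x) (vapp f y)"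
  using mono_maps_mono[OF finite_D D_arrow] .

lemma D_eta: "f \<in> D k (A \<rightarrow> B) \<Longrightarrow> vlam (D k A) (vapp f) = f"
  using mono_maps_eta[OF finite_D D_arrow, symmetric] .

lemma le_refl: "x \<in> D k A \<Longrightarrow> le k A x x"
  by (induction A arbitrary: x) (auto intro: D_app)

lemma le_trans:
  "x \<in> D k A \<Longrightarrow> y \<in> D k A \<Longrightarrow> z \<in> D k A \<Longrightarrow> le k A x y \<Longrightarrow> le k A y z \<Longrightarrow> le k A x z"
proof (induction A arbitrary: x y z)
  case (Arr A B)
  show ?case
    using Arr.IH(2)[OF D_app[OF Arr.prems(1)] D_app[OF Arr.prems(2)] D_app[OF Arr.prems(3)]] Arr.prems(4,5)
    by auto
qed auto

lemma le_antisym: "x \<in> D k A \<Longrightarrow> y \<in> D k A \<Longrightarrow> le k A x y \<Longrightarrow> le k A y x \<Longrightarrow> x = y"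
proof (induction A arbitrary: x y)
  case (Arr A B)
  have "vapp x z = vapp y z" if "z \<in> D k A" for z
    using Arr.IH(2)[OF D_app[OF Arr.prems(1)] D_app[OF Arr.prems(2)]] Arr.prems(3,4) that by auto
  then have "vlam (D k A) (vapp x) = vlam (D k A) (vapp y)" by (rule vlam_cong)
  then show ?case by (simp only: D_eta[OF Arr.prems(1)] D_eta[OF Arr.prems(2)])
qed auto

lemma the_greatest:
  "is_greatest (le k A) X e \<Longrightarrow> X \<subseteq> D k A \<Longrightarrow> (THE e. is_greatest (le k A) X e) = e"
  by (rule the_equality) (auto simp: is_greatest_def subset_iff intro!: le_antisym)

lemma the_least:
  "is_least (le k A) X e \<Longrightarrow> X \<subseteq> D k A \<Longrightarrow> (THE e. is_least (le k A) X e) = e"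
  by (rule the_equality) (auto simp: is_least_def subset_iff intro!: le_antisym)

text \<open>Explicit forms of \<open>e\<^sup>\<down>\<close> and, for \<open>b\<close> true or false, of \<open>d\<^sup>\<up>\<^sup>\<top>\<close> and \<open>d\<^sup>\<up>\<^sup>\<bottom>\<close>; here \<open>k\<close> is the lower level.\<close>

fun dn :: "nat \<Rightarrow> ty \<Rightarrow> 'q val \<Rightarrow> 'q val" and up :: "bool \<Rightarrow> nat \<Rightarrow> ty \<Rightarrow> 'q val \<Rightarrow> 'q val" where
  "dn k \<o> e = VSet (the_set e \<inter> Qle k)"
| "dn k (A \<rightarrow> B) f = vlam (D k A) (\<lambda>x. dn k B (vapp f (up True k A x)))"
| "up b k \<o> d = VSet (the_set d \<union> (if b then Qle (Suc k) - Qle k else {}))"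
| "up b k (A \<rightarrow> B) f = vlam (D (Suc k) A) (\<lambda>x. up b k B (vapp f (dn k A x)))"

lemma L_app: "(f, f') \<in> L k (A \<rightarrow> B) \<Longrightarrow> (x, x') \<in> L k A \<Longrightarrow> (vapp f x, vapp f' x') \<in> L k B"
  by auto

text \<open>The conjuncts make \<L> the graph of the map \<open>dn\<close>, with the two
  \<open>up\<close> lifts as the bounds of each fibre. They need one simultaneous induction: at an
  arrow type, \<open>dn\<close> lifts the argument by \<open>up\<close> and \<open>up\<close> lowers
  it by \<open>dn\<close>.\<close>

lemma L_characterization:
  "(\<forall>e \<in> D (Suc k) A. (dn k A e, e) \<in> L k A) \<and>
   (\<forall>d e. (d, e) \<in> L k A \<longrightarrow> d \<in> D k A \<and> e \<in> D (Suc k) A \<and> d = dn k A e \<and>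
      le (Suc k) A e (up True k A d) \<and> le (Suc k) A (up False k A d) e) \<and>
   (\<forall>b. \<forall>d \<in> D k A. (d, up b k A d) \<in> L k A) \<and>
   (\<forall>e \<in> D (Suc k) A. \<forall>e' \<in> D (Suc k) A. le (Suc k) A e e' \<longrightarrow> le k A (dn k A e) (dn k A e')) \<and>
   (\<forall>b. \<forall>d \<in> D k A. \<forall>d' \<in> D k A. le k A d d' \<longrightarrow> le (Suc k) A (up b k A d) (up b k A d'))"
proof (induction A)
  case Base
  have "Qle k \<subseteq> Qle (Suc k)" by (rule Qle_mono) simp
  then show ?case
    by (auto simp: image_iff split: if_splits)
next
  case (Arr A B)
  have dnA: "(dn k A e, e) \<in> L k A" if "e \<in> D (Suc k) A" for e using Arr.IH(1) that by blast
  have LA: "d \<in> D k A \<and> e \<in> D (Suc k) A \<and> d = dn k A e" if "(d, e) \<in> L k A" for d e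
    using Arr.IH(1) that by blast
  have upA: "(d, up b k A d) \<in> L k A" if "d \<in> D k A" for d b using Arr.IH(1) that by blast
  have dnA_mono: "le k A (dn k A e) (dn k A e')"
    if "e \<in> D (Suc k) A" "e' \<in> D (Suc k) A" "le (Suc k) A e e'" for e e'
    using Arr.IH(1) that by blast
  have LB: "d \<in> D k B \<and> e \<in> D (Suc k) B \<and> d = dn k B e \<and>
      le (Suc k) B e (up True k B d) \<and> le (Suc k) B (up False k B d) e" if "(d, e) \<in> L k B" for d e
    using Arr.IH(2) that by blast
  have upB: "(d, up b k B d) \<in> L k B" if "d \<in> D k B" for d b using Arr.IH(2) that by blast
  have dnB_mono: "le k B (dn k B e) (dn k B e')"
    if "e \<in> D (Suc k) B" "e' \<in> D (Suc k) B" "le (Suc k) B e e'" for e e'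
    using Arr.IH(2) that by blast
  have upB_mono: "le (Suc k) B (up b k B d) (up b k B d')"
    if "d \<in> D k B" "d' \<in> D k B" "le k B d d'" for b d d'
    using Arr.IH(2) that by blast
  have dnA_D: "dn k A e \<in> D k A" if "e \<in> D (Suc k) A" for e using dnA LA that by blast
  have upA_D: "up b k A d \<in> D (Suc k) A" if "d \<in> D k A" for d b using upA LA that by blast
  have upB_D: "up b k B d \<in> D (Suc k) B" if "d \<in> D k B" for d b using upB LB that by blast
  have up: "(f, up b k (A \<rightarrow> B) f) \<in> L k (A \<rightarrow> B)" if f: "f \<in> D k (A \<rightarrow> B)" for b f
  proof -
    have "up b k (A \<rightarrow> B) f \<in> mono_maps (D (Suc k) A) (le (Suc k) A) (D (Suc k) B) (le (Suc k) B)"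
      unfolding up.simps
      by (rule vlam_in_mono_maps) (use f in \<open>auto intro!: upB_D upB_mono dnA_D dnA_mono D_app[OF f] D_mono[OF f]\<close>)
    moreover have "(vapp f g1, vapp (up b k (A \<rightarrow> B) f) g2) \<in> L k B" if "(g1, g2) \<in> L k A" for g1 g2
      using LA[OF that] upB[OF D_app[OF f]] by (auto simp del: Rel.simps)
    ultimately show ?thesis using f by auto
  qed
  have L: "d \<in> D k (A \<rightarrow> B) \<and> e \<in> D (Suc k) (A \<rightarrow> B) \<and> d = dn k (A \<rightarrow> B) e \<and>
      le (Suc k) (A \<rightarrow> B) e (up True k (A \<rightarrow> B) d) \<and> le (Suc k) (A \<rightarrow> B) (up False k (A \<rightarrow> B) d) e"
    if de: "(d, e) \<in> L k (A \<rightarrow> B)" for d e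
  proof -
    have d: "d \<in> D k (A \<rightarrow> B)" and e: "e \<in> D (Suc k) (A \<rightarrow> B)" using de by auto
    \<comment> \<open>Relatedness forces this value for every lift of \<open>x\<close>, so fixing
      one lift in the definition of \<open>dn\<close> loses nothing.\<close>
    have "vapp d x = dn k B (vapp e (up True k A x))" if "x \<in> D k A" for x
      using LB L_app[OF de upA[OF that]] by blast
    then have "vlam (D k A) (vapp d) = dn k (A \<rightarrow> B) e" unfolding dn.simps by (rule vlam_cong)
    then have "d = dn k (A \<rightarrow> B) e" unfolding D_eta[OF d] .
    moreover have "le (Suc k) B (vapp e x) (up True k B (vapp d (dn k A x)))"
      "le (Suc k) B (up False k B (vapp d (dn k A x))) (vapp e x)" if "x \<in> D (Suc k) A" for x
      using LB[OF L_app[OF de dnA[OF that]]] by auto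
    ultimately show ?thesis using d e by simp
  qed
  have dn: "(dn k (A \<rightarrow> B) e, e) \<in> L k (A \<rightarrow> B)" if "e \<in> D (Suc k) (A \<rightarrow> B)" for e
  proof -
    from that obtain d where "(d, e) \<in> L k (A \<rightarrow> B)" by auto
    with L show ?thesis by metis
  qed
  have dn_mono: "le k (A \<rightarrow> B) (dn k (A \<rightarrow> B) e) (dn k (A \<rightarrow> B) e')"
    if "e \<in> D (Suc k) (A \<rightarrow> B)" "e' \<in> D (Suc k) (A \<rightarrow> B)" "le (Suc k) (A \<rightarrow> B) e e'" for e e'
    using that upA_D by (auto intro!: dnB_mono simp: D_app simp del: Dom.simps)
  have up_mono: "le (Suc k) (A \<rightarrow> B) (up b k (A \<rightarrow> B) d) (up b k (A \<rightarrow> B) d')"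
    if "d \<in> D k (A \<rightarrow> B)" "d' \<in> D k (A \<rightarrow> B)" "le k (A \<rightarrow> B) d d'" for b d d'
    using that dnA_D by (auto intro!: upB_mono simp: D_app simp del: Dom.simps)
  from up L dn dn_mono up_mono show ?case by blast
qed

lemma dn_L: "e \<in> D (Suc k) A \<Longrightarrow> (dn k A e, e) \<in> L k A"
  and up_L: "d \<in> D k A \<Longrightarrow> (d, up b k A d) \<in> L k A"
  and L_D: "(d, e) \<in> L k A \<Longrightarrow> d \<in> D k A" "(d, e) \<in> L k A \<Longrightarrow> e \<in> D (Suc k) A"
  and L_dn: "(d, e) \<in> L k A \<Longrightarrow> d = dn k A e"
  and L_le_up: "(d, e) \<in> L k A \<Longrightarrow> le (Suc k) A e (up True k A d)"
  and L_up_le: "(d, e) \<in> L k A \<Longrightarrow> le (Suc k) A (up False k A d) e"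
  and dn_mono: "e \<in> D (Suc k) A \<Longrightarrow> e' \<in> D (Suc k) A \<Longrightarrow> le (Suc k) A e e' \<Longrightarrow> le k A (dn k A e) (dn k A e')"
  and up_mono: "d \<in> D k A \<Longrightarrow> d' \<in> D k A \<Longrightarrow> le k A d d' \<Longrightarrow> le (Suc k) A (up b k A d) (up b k A d')"
  using L_characterization[of k A] by blast+

lemma dn_D: "e \<in> D (Suc k) A \<Longrightarrow> dn k A e \<in> D k A"
  using dn_L L_D by blast

text \<open>The lifted function looks at its argument only through \<open>dn\<close>, so its value
  depends on \<open>y\<close> alone. This is what keeps extremal elements extremal under
  application.\<close>

lemma up_app:
  "(y, x) \<in> L k A \<Longrightarrow> vapp (up b k (A \<rightarrow> B) f) x = up b k B (vapp f y)"
  using L_D(2) L_dn by simp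

lemma L_vlam:
  assumes "vlam (D k A) F \<in> D k (A \<rightarrow> B)"
    and FG: "\<And>x y. (x, y) \<in> L k A \<Longrightarrow> (F x, G y) \<in> L k B"
    and "\<And>x y. x \<in> D (Suc k) A \<Longrightarrow> y \<in> D (Suc k) A \<Longrightarrow> le (Suc k) A x y \<Longrightarrow> le (Suc k) B (G x) (G y)"
  shows "(vlam (D k A) F, vlam (D (Suc k) A) G) \<in> L k (A \<rightarrow> B)"
proof -
  have "vlam (D (Suc k) A) G \<in> mono_maps (D (Suc k) A) (le (Suc k) A) (D (Suc k) B) (le (Suc k) B)"
    using assms(3) L_D(2)[OF FG[OF dn_L]] by (rule vlam_in_mono_maps[rotated])
  moreover have "(vapp (vlam (D k A) F) x, vapp (vlam (D (Suc k) A) G) y) \<in> L k B"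
    if "(x, y) \<in> L k A" for x y
    using FG[OF that] L_D[OF that] by simp
  ultimately show ?thesis using assms(1) by auto
qed

declare Dom.simps(2,3) [simp del] Rel.simps(3) [simp del]

section \<open>The explicit forms agree with the operators of the model\<close>

lemma down_eq: "e \<in> D (Suc k) A \<Longrightarrow> down \<A> (Suc k) A e = dn k A e"
  unfolding down_def using dn_L L_dn by blast

lemma up_top_eq: "d \<in> D k A \<Longrightarrow> up_top \<A> (Suc k) A d = up True k A d"
  unfolding up_top_def
  by (rule the_greatest) (auto simp: is_greatest_def up_L L_le_up L_D)

lemma up_bot_eq: "d \<in> D k A \<Longrightarrow> up_bot \<A> (Suc k) A d = up False k A d"
  unfolding up_bot_def
  by (rule the_least) (auto simp: is_least_def up_L L_up_le L_D)

lemma Top_greatest: "is_greatest (le 0 A) (D 0 A) (Top \<A> 0 A)"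
  and Top_Base: "Top \<A> 0 \<o> = VSet (Qle 0)"
  and Top_app: "x \<in> D 0 A \<Longrightarrow> vapp (Top \<A> 0 (A \<rightarrow> B)) x = Top \<A> 0 B"
proof -
  have base: "is_greatest (le 0 \<o>) (D 0 \<o>) (VSet (Qle 0))"
    by (auto simp: is_greatest_def)
  then show Top_Base: "Top \<A> 0 \<o> = VSet (Qle 0)"
    unfolding Top_def by (rule the_greatest) simp
  have arr: "is_greatest (le 0 (A \<rightarrow> B)) (D 0 (A \<rightarrow> B)) (vlam (D 0 A) (\<lambda>_. Top \<A> 0 B))"
    if "is_greatest (le 0 B) (D 0 B) (Top \<A> 0 B)" for A B
    using that
    by (auto simp: is_greatest_def Dom.simps(2) intro!: vlam_in_mono_maps le_refl dest: mono_maps_app[OF finite_D])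
  have greatest: "is_greatest (le 0 A) (D 0 A) (Top \<A> 0 A)" for A
  proof (induction A)
    case Base
    show ?case using base by (simp add: Top_Base)
  next
    case (Arr A B)
    from the_greatest[OF arr[OF Arr.IH(2), of A] order_refl] arr[OF Arr.IH(2), of A]
    show ?case unfolding Top_def by simp
  qed
  then show "is_greatest (le 0 A) (D 0 A) (Top \<A> 0 A)" .
  have "Top \<A> 0 (A \<rightarrow> B) = vlam (D 0 A) (\<lambda>_. Top \<A> 0 B)"
    using the_greatest[OF arr[OF greatest] order_refl] unfolding Top_def .
  then show "x \<in> D 0 A \<Longrightarrow> vapp (Top \<A> 0 (A \<rightarrow> B)) x = Top \<A> 0 B" by simp
qed

section \<open>Fixpoints\<close>

text \<open>The element from which the iteration in \<open>fixp\<close> starts.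
  \<open>even (Suc k)\<close> is the boolean that selects the greatest or the least lift, so both
  parities share one equation.\<close>

primrec fix_start :: "nat \<Rightarrow> ty \<Rightarrow> 'q val \<Rightarrow> 'q val" where
  "fix_start 0 A f = Top \<A> 0 A"
| "fix_start (Suc k) A f = up (even (Suc k)) k A (fixp \<A> k A (dn k (A \<rightarrow> A) f))"

lemma iterate_D: "f \<in> D k (A \<rightarrow> A) \<Longrightarrow> e \<in> D k A \<Longrightarrow> (vapp f ^^ n) e \<in> D k A"
  by (induction n) (auto intro: D_app)

lemma iterate_le:
  assumes "f \<in> D k (A \<rightarrow> A)" "f' \<in> D k (A \<rightarrow> A)" "le k (A \<rightarrow> A) f f'"
    and "e \<in> D k A" "e' \<in> D k A" "le k A e e'"
  shows "le k A ((vapp f ^^ n) e) ((vapp f' ^^ n) e')"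
proof (induction n)
  case (Suc n)
  let ?x = "(vapp f ^^ n) e" and ?y = "(vapp f' ^^ n) e'"
  have "?x \<in> D k A" "?y \<in> D k A" using assms by (auto intro: iterate_D)
  then have "le k A (vapp f ?x) (vapp f ?y)" "le k A (vapp f ?y) (vapp f' ?y)"
    using Suc assms by (auto intro: D_mono)
  then show ?case
    using le_trans[of "vapp f ?x" k A "vapp f ?y" "vapp f' ?y"] \<open>?x \<in> D k A\<close> \<open>?y \<in> D k A\<close> assms
    by (auto intro: D_app)
qed (use assms in simp)

text \<open>The order is reversed when \<open>b\<close> is false, so one argument serves meets and
  joins: the iterates stabilize, and the stable value is itself the bound.\<close>

lemma limit_of_iterates:
  assumes f: "f \<in> D k (A \<rightarrow> A)" and e: "e \<in> D k A"
    and "if b then le k A (vapp f e) e else le k A e (vapp f e)"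
  defines "X \<equiv> {(vapp f ^^ n) e | n. True}"
  defines "x \<equiv> if b then Meet \<A> k A X else Join \<A> k A X"
  shows "x \<in> X" "vapp f x = x" "if b then le k A x ((vapp f ^^ n) e) else le k A ((vapp f ^^ n) e) x"
proof -
  let ?r = "\<lambda>x y. if b then le k A x y else le k A y x"
  have "\<exists>n. vapp f ((vapp f ^^ n) e) = (vapp f ^^ n) e \<and> (\<forall>m. ?r ((vapp f ^^ n) e) ((vapp f ^^ m) e))"
  proof (rule descending_iterates_stabilize[where X = "D k A"])
    show "\<And>x y z. x \<in> D k A \<Longrightarrow> y \<in> D k A \<Longrightarrow> z \<in> D k A \<Longrightarrow> ?r x y \<Longrightarrow> ?r y z \<Longrightarrow> ?r x z"
      by (auto split: if_splits intro: le_trans)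
    show "\<And>x y. x \<in> D k A \<Longrightarrow> y \<in> D k A \<Longrightarrow> ?r x y \<Longrightarrow> ?r y x \<Longrightarrow> x = y"
      by (auto split: if_splits intro: le_antisym)
  qed (use assms in \<open>auto simp: le_refl D_app D_mono split: if_splits\<close>)
  then obtain n where n: "vapp f ((vapp f ^^ n) e) = (vapp f ^^ n) e"
      "\<And>m. ?r ((vapp f ^^ n) e) ((vapp f ^^ m) e)" by blast
  have "x = (vapp f ^^ n) e"
  proof (cases b)
    case True
    have "is_greatest (le k A) {d \<in> D k A. \<forall>x\<in>X. le k A d x} ((vapp f ^^ n) e)"
      using n(2) True iterate_D[OF f e] by (auto simp: is_greatest_def X_def)
    from the_greatest[OF this] show ?thesis by (auto simp: x_def Meet_def True)
  next
    case False
    have "is_least (le k A) {d \<in> D k A. \<forall>x\<in>X. le k A x d} ((vapp f ^^ n) e)"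
      using n(2) False iterate_D[OF f e] by (auto simp: is_least_def X_def)
    from the_least[OF this] show ?thesis by (auto simp: x_def Join_def False)
  qed
  with n show "x \<in> X" "vapp f x = x" "?r x ((vapp f ^^ n) e)" for n
    by (auto simp: X_def)
qed

text \<open>\<open>f\<close> maps the fibre over \<open>d\<close> into the fibre over
  \<open>vapp g d\<close>; if \<open>d\<close> is a fixpoint of \<open>g\<close>, all iterates stay
  in one fibre.\<close>

lemma L_iterate:
  "(d, e) \<in> L k A \<Longrightarrow> (g, f) \<in> L k (A \<rightarrow> A) \<Longrightarrow> vapp g d = d \<Longrightarrow> (d, (vapp f ^^ n) e) \<in> L k A"
proof (induction n)
  case (Suc n)
  then show ?case using L_app[of g f k A A d "(vapp f ^^ n) e"] by simp
qed simp

text \<open>One induction on the level proves everything together. Iteration at \<open>Suc k\<close>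
  starts over the fixpoint at \<open>k\<close>: keeping it in that fibre takes the fixpoint equation
  at \<open>k\<close>, and comparing two starting points takes monotonicity at
  \<open>k\<close>.\<close>

lemma fixp_properties:
  assumes "f \<in> D k (A \<rightarrow> A)"
  shows "fixp \<A> k A f \<in> D k A \<and> vapp f (fixp \<A> k A f) = fixp \<A> k A f \<and>
    (\<exists>n. fixp \<A> k A f = (vapp f ^^ n) (fix_start k A f)) \<and>
    (\<forall>f' \<in> D k (A \<rightarrow> A). le k (A \<rightarrow> A) f f' \<longrightarrow> le k A (fixp \<A> k A f) (fixp \<A> k A f')) \<and>
    (\<forall>j. k = Suc j \<longrightarrow> (fixp \<A> j A (dn j (A \<rightarrow> A) f), fixp \<A> k A f) \<in> L j A)"
  using assms
proof (induction k arbitrary: f)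
  case 0
  let ?T = "Top \<A> 0 A"
  have T: "?T \<in> D 0 A" "\<And>x. x \<in> D 0 A \<Longrightarrow> le 0 A x ?T"
    using Top_greatest[of A] by (auto simp: is_greatest_def)
  have lim: "\<exists>n. fixp \<A> 0 A f = (vapp f ^^ n) ?T" "vapp f (fixp \<A> 0 A f) = fixp \<A> 0 A f"
    "le 0 A (fixp \<A> 0 A f) ((vapp f ^^ n) ?T)" if f: "f \<in> D 0 (A \<rightarrow> A)" for f n
    using limit_of_iterates[OF f T(1), of True] T f D_app[OF f T(1)] by auto
  have memb: "fixp \<A> 0 A f \<in> D 0 A" if f: "f \<in> D 0 (A \<rightarrow> A)" for f
    using lim(1)[OF f] iterate_D[OF f T(1)] by auto
  have "le 0 A (fixp \<A> 0 A f) (fixp \<A> 0 A f')" if f': "f' \<in> D 0 (A \<rightarrow> A)" "le 0 (A \<rightarrow> A) f f'" for f'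
  proof -
    obtain n where n: "fixp \<A> 0 A f' = (vapp f' ^^ n) ?T" using lim(1)[OF f'(1)] by blast
    show ?thesis unfolding n
      using le_trans[OF memb[OF 0] iterate_D[OF 0 T(1)] iterate_D[OF f'(1) T(1)] lim(3)[OF 0]
          iterate_le[OF 0 f' T(1) T(1) le_refl[OF T(1)]]] .
  qed
  with lim[OF 0] memb[OF 0] show ?case by (auto simp del: fixp.simps)
next
  case (Suc k)
  let ?b = "even (Suc k)"
  let ?fix = "\<lambda>f. fixp \<A> k A (dn k (A \<rightarrow> A) f)"
  let ?e = "\<lambda>f. fix_start (Suc k) A f"
  have fix_D: "?fix f \<in> D k A" and fix_fix: "vapp (dn k (A \<rightarrow> A) f) (?fix f) = ?fix f"
    if "f \<in> D (Suc k) (A \<rightarrow> A)" for f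
    using Suc.IH[OF dn_D[OF that]] by blast+
  have fix_mono: "le k A (?fix f) (?fix f')"
    if "f \<in> D (Suc k) (A \<rightarrow> A)" "f' \<in> D (Suc k) (A \<rightarrow> A)" "le (Suc k) (A \<rightarrow> A) f f'" for f f'
    using Suc.IH[OF dn_D[OF that(1)]] dn_D[OF that(2)] dn_mono[OF that] by blast
  have e_L: "(?fix f, ?e f) \<in> L k A" if "f \<in> D (Suc k) (A \<rightarrow> A)" for f
    using up_L[OF fix_D[OF that]] by simp
  have e: "?e f \<in> D (Suc k) A" if "f \<in> D (Suc k) (A \<rightarrow> A)" for f
    using L_D[OF e_L[OF that]] by blast
  have iter_L: "(?fix f, (vapp f ^^ n) (?e f)) \<in> L k A" if "f \<in> D (Suc k) (A \<rightarrow> A)" for f n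
    by (rule L_iterate[OF e_L[OF that] dn_L[OF that] fix_fix[OF that]])
  \<comment> \<open>One application of \<open>f\<close> stays in the fibre of which
    \<open>?e f\<close> is the greatest or least element; this gives the iteration its
    direction.\<close>
  have start: "if ?b then le (Suc k) A (vapp f (?e f)) (?e f) else le (Suc k) A (?e f) (vapp f (?e f))"
    if "f \<in> D (Suc k) (A \<rightarrow> A)" for f
    using L_le_up[OF iter_L[OF that, of 1]] L_up_le[OF iter_L[OF that, of 1]] by auto
  have fixp_eq: "fixp \<A> (Suc k) A f =
      (if ?b then Meet \<A> (Suc k) A {(vapp f ^^ n) (?e f) | n. True}
       else Join \<A> (Suc k) A {(vapp f ^^ n) (?e f) | n. True})"
    if "f \<in> D (Suc k) (A \<rightarrow> A)" for f
    using down_eq[OF that] up_top_eq[OF fix_D[OF that]] up_bot_eq[OF fix_D[OF that]]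
    by (simp add: Let_def)
  have lim: "fixp \<A> (Suc k) A f \<in> {(vapp f ^^ n) (?e f) | n. True}"
    "vapp f (fixp \<A> (Suc k) A f) = fixp \<A> (Suc k) A f"
    "if ?b then le (Suc k) A (fixp \<A> (Suc k) A f) ((vapp f ^^ n) (?e f))
     else le (Suc k) A ((vapp f ^^ n) (?e f)) (fixp \<A> (Suc k) A f)"
    if f: "f \<in> D (Suc k) (A \<rightarrow> A)" for f n
    using limit_of_iterates[OF f e[OF f] start[OF f]] unfolding fixp_eq[OF f] by blast+
  have iter: "\<exists>n. fixp \<A> (Suc k) A f = (vapp f ^^ n) (?e f)" if "f \<in> D (Suc k) (A \<rightarrow> A)" for f
    using lim(1)[OF that] by blast
  have memb: "fixp \<A> (Suc k) A f \<in> D (Suc k) A" if f: "f \<in> D (Suc k) (A \<rightarrow> A)" for f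
    using iter[OF f] iterate_D[OF f e[OF f]] by auto
  have "le (Suc k) A (fixp \<A> (Suc k) A f) (fixp \<A> (Suc k) A f')"
    if f': "f' \<in> D (Suc k) (A \<rightarrow> A)" "le (Suc k) (A \<rightarrow> A) f f'" for f'
  proof -
    have le: "le (Suc k) A ((vapp f ^^ n) (?e f)) ((vapp f' ^^ n) (?e f'))" for n
      using iterate_le[OF Suc.prems f' e[OF Suc.prems] e[OF f'(1)]]
        up_mono[OF fix_D[OF Suc.prems] fix_D[OF f'(1)] fix_mono[OF Suc.prems f']] by simp
    note in_D = memb[OF Suc.prems] memb[OF f'(1)]
      iterate_D[OF Suc.prems e[OF Suc.prems]] iterate_D[OF f'(1) e[OF f'(1)]]
    obtain n n' where n: "fixp \<A> (Suc k) A f = (vapp f ^^ n) (?e f)"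
      "fixp \<A> (Suc k) A f' = (vapp f' ^^ n') (?e f')" using iter Suc.prems f'(1) by blast
    show ?thesis
    \<comment> \<open>A meet lies below every iterate of \<open>f\<close>, so the index can be the
      one where \<open>f'\<close> attains its fixpoint; for joins it is the index where
      \<open>f\<close> does.\<close>
    proof (cases ?b)
      case True
      then have "le (Suc k) A (fixp \<A> (Suc k) A f) ((vapp f ^^ n') (?e f))"
        using lim(3)[OF Suc.prems, of n'] by meson
      from le_trans[OF in_D(1,3,4) this le] n(2) show ?thesis by simp
    next
      case False
      then have "le (Suc k) A ((vapp f' ^^ n) (?e f')) (fixp \<A> (Suc k) A f')"
        using lim(3)[OF f'(1), of n] by meson
      from le_trans[OF in_D(3,4,2) le this] n(1) show ?thesis by simp
    qed
  qed
  moreover have "(?fix f, fixp \<A> (Suc k) A f) \<in> L k A"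
    using iter[OF Suc.prems] iter_L[OF Suc.prems] by metis
  moreover note iter[OF Suc.prems] memb[OF Suc.prems] lim(2)[OF Suc.prems]
  ultimately show ?case by blast
qed

section \<open>The interpretation\<close>

abbreviation "sem \<equiv> interp \<A>"

lemma delta2_weak:
  "q \<in> states \<A> \<Longrightarrow> signature \<A> a = Some (\<o> \<rightarrow> \<o> \<rightarrow> \<o>) \<Longrightarrow> (S0, S1) \<in> delta2 \<A> q a \<Longrightarrow>
     S0 \<subseteq> Qle (rank \<A> q) \<and> S1 \<subseteq> Qle (rank \<A> q)"
  using weak unfolding weak_def by blast

lemma delta2_mono:
  "q \<in> states \<A> \<Longrightarrow> signature \<A> a = Some (\<o> \<rightarrow> \<o> \<rightarrow> \<o>) \<Longrightarrow> (S0, S1) \<in> delta2 \<A> q a \<Longrightarrow>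
     S0 \<subseteq> S0' \<Longrightarrow> S0' \<subseteq> Qle (rank \<A> q) \<Longrightarrow> S1 \<subseteq> S1' \<Longrightarrow> S1' \<subseteq> Qle (rank \<A> q) \<Longrightarrow>
     (S0', S1') \<in> delta2 \<A> q a"
  using monotone unfolding monotone_transitions_def by blast

lemma const2_mono:
  assumes a: "signature \<A> a = Some (\<o> \<rightarrow> \<o> \<rightarrow> \<o>)" and "S0 \<subseteq> S0'" "S1 \<subseteq> S1'"
  shows "const2 \<A> k a S0 S1 \<subseteq> const2 \<A> k a S0' S1'"
proof
  fix q assume "q \<in> const2 \<A> k a S0 S1"
  then have "q \<in> Qle k" "q \<in> states \<A>"
    "(S0 \<inter> Qle (rank \<A> q), S1 \<inter> Qle (rank \<A> q)) \<in> delta2 \<A> q a"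
    by (auto simp: const2_def Q_le_def)
  with delta2_mono[OF _ a this(3), of "S0' \<inter> Qle (rank \<A> q)" "S1' \<inter> Qle (rank \<A> q)"] assms
  show "q \<in> const2 \<A> k a S0' S1'" by (auto simp: const2_def)
qed

text \<open>A state of rank at most \<open>k\<close> sees its arguments only up to its own rank, so
  cutting them at \<open>k\<close> changes nothing. This is the coherence of constants between
  levels.\<close>

lemma const2_restrict: "const2 \<A> k a (S0 \<inter> Qle k) (S1 \<inter> Qle k) = const2 \<A> (Suc k) a S0 S1 \<inter> Qle k"
proof -
  have "S \<inter> Qle k \<inter> Qle (rank \<A> q) = S \<inter> Qle (rank \<A> q)" if "q \<in> Qle k" for S q
    using that Qle_mono[of "rank \<A> q" k] by (auto simp: Q_le_def)
  moreover have "Qle k \<subseteq> Qle (Suc k)" by (simp add: Qle_mono)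
  ultimately show ?thesis by (auto simp: const2_def)
qed

lemma const2_subset: "const2 \<A> k a S0 S1 \<subseteq> Qle k"
  by (auto simp: const2_def)

lemma vlam_D0:
  "(\<And>x. x \<in> D 0 A \<Longrightarrow> F x \<in> D 0 B) \<Longrightarrow>
   (\<And>x y. x \<in> D 0 A \<Longrightarrow> y \<in> D 0 A \<Longrightarrow> le 0 A x y \<Longrightarrow> le 0 B (F x) (F y)) \<Longrightarrow> vlam (D 0 A) F \<in> D 0 (A \<rightarrow> B)"
  unfolding Dom.simps(2) by (rule vlam_in_mono_maps)

abbreviation binary :: "nat \<Rightarrow> 'c \<Rightarrow> 'q val \<Rightarrow> 'q val" where
  "binary k a x \<equiv> vlam (D k \<o>) (\<lambda>y. VSet (const2 \<A> k a (the_set x) (the_set y)))"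

lemma const_interp_binary:
  "signature \<A> a = Some (\<o> \<rightarrow> \<o> \<rightarrow> \<o>) \<Longrightarrow> const_interp \<A> k a = vlam (D k \<o>) (binary k a)"
  by (simp add: const_interp_def)

lemma const_interp_D0:
  assumes "signature \<A> c = Some A"
  shows "const_interp \<A> 0 c \<in> D 0 A"
proof (cases rule: signature_cases[OF assms])
  case 1
  with assms show ?thesis by (auto simp: const_interp_def)
next
  case 2
  have a: "signature \<A> c = Some (\<o> \<rightarrow> \<o> \<rightarrow> \<o>)" using assms 2 by simp
  have "VSet (const2 \<A> 0 c S0 S1) \<in> D 0 \<o>" for S0 S1
    using const2_subset by auto
  then have "binary 0 c x \<in> D 0 (\<o> \<rightarrow> \<o>)" for x
    by (rule vlam_D0) (use const2_mono[OF a] in auto)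
  then show ?thesis unfolding 2 const_interp_binary[OF a]
  proof (rule vlam_D0)
    fix x y assume "le 0 \<o> x y"
    then have "const2 \<A> 0 c (the_set x) (the_set z) \<subseteq> const2 \<A> 0 c (the_set y) (the_set z)" for z
      by (intro const2_mono[OF a]) auto
    then show "le 0 (\<o> \<rightarrow> \<o>) (binary 0 c x) (binary 0 c y)" by (simp del: Dom.simps)
  qed
qed

lemma const_interp_L:
  assumes "signature \<A> c = Some A" "const_interp \<A> k c \<in> D k A"
  shows "(const_interp \<A> k c, const_interp \<A> (Suc k) c) \<in> L k A"
proof (cases rule: signature_cases[OF assms(1)])
  case 1
  with assms Qle_mono[of k "Suc k"] show ?thesis by (auto simp: const_interp_def)
next
  case 2
  have a: "signature \<A> c = Some (\<o> \<rightarrow> \<o> \<rightarrow> \<o>)" using assms 2 by simp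
  have D: "vlam (D k \<o>) (binary k c) \<in> D k (\<o> \<rightarrow> \<o> \<rightarrow> \<o>)"
    using assms(2) unfolding 2 const_interp_binary[OF a] .
  show ?thesis unfolding 2 const_interp_binary[OF a]
  proof (rule L_vlam[OF D])
    fix x y assume xy: "(x, y) \<in> L k \<o>"
    show "(binary k c x, binary (Suc k) c y) \<in> L k (\<o> \<rightarrow> \<o>)"
    proof (rule L_vlam)
      show "binary k c x \<in> D k (\<o> \<rightarrow> \<o>)"
        using D_app[OF D] L_D(1)[OF xy] by (metis vapp_vlam finite_D)
      fix x' y' assume "(x', y') \<in> L k \<o>"
      with xy show "(VSet (const2 \<A> k c (the_set x) (the_set x')),
          VSet (const2 \<A> (Suc k) c (the_set y) (the_set y'))) \<in> L k \<o>"
        using const2_subset const2_restrict by auto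
    qed (use const2_mono[OF a] in auto)
  next
    fix x y assume "le (Suc k) \<o> x y"
    then have "const2 \<A> (Suc k) c (the_set x) (the_set z) \<subseteq> const2 \<A> (Suc k) c (the_set y) (the_set z)" for z
      by (intro const2_mono[OF a]) auto
    then show "le (Suc k) (\<o> \<rightarrow> \<o>) (binary (Suc k) c x) (binary (Suc k) c y)" by (simp del: Dom.simps)
  qed
qed

section \<open>Membership, monotonicity and coherence of the interpretation\<close>

definition env_le :: "nat \<Rightarrow> ty list \<Rightarrow> 'q val list \<Rightarrow> 'q val list \<Rightarrow> bool" where
  "env_le k \<Gamma> \<nu> \<nu>' \<longleftrightarrow>
     (\<forall>i < length \<Gamma>. \<nu> ! i \<in> D k (\<Gamma> ! i) \<and> \<nu>' ! i \<in> D k (\<Gamma> ! i) \<and> le k (\<Gamma> ! i) (\<nu> ! i) (\<nu>' ! i))"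

definition env_L :: "nat \<Rightarrow> ty list \<Rightarrow> 'q val list \<Rightarrow> 'q val list \<Rightarrow> bool" where
  "env_L k \<Gamma> \<nu> \<nu>' \<longleftrightarrow> (\<forall>i < length \<Gamma>. (\<nu> ! i, \<nu>' ! i) \<in> L k (\<Gamma> ! i))"

lemma env_le_Cons:
  "env_le k (A # \<Gamma>) (x # \<nu>) (y # \<nu>') \<longleftrightarrow> x \<in> D k A \<and> y \<in> D k A \<and> le k A x y \<and> env_le k \<Gamma> \<nu> \<nu>'"
  unfolding env_le_def by (simp add: All_less_Suc2)

lemma env_L_Cons:
  "env_L k (A # \<Gamma>) (x # \<nu>) (y # \<nu>') \<longleftrightarrow> (x, y) \<in> L k A \<and> env_L k \<Gamma> \<nu> \<nu>'"
  unfolding env_L_def by (simp add: All_less_Suc2)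

lemma env_le_refl: "env_le k \<Gamma> \<nu> \<nu>' \<Longrightarrow> env_le k \<Gamma> \<nu> \<nu> \<and> env_le k \<Gamma> \<nu>' \<nu>'"
  by (auto simp: env_le_def le_refl)

lemma app_le:
  assumes "f \<in> D k (A \<rightarrow> B)" "f' \<in> D k (A \<rightarrow> B)" "le k (A \<rightarrow> B) f f'" "x \<in> D k A" "x' \<in> D k A" "le k A x x'"
  shows "le k B (vapp f x) (vapp f' x')"
proof (rule le_trans)
  show "le k B (vapp f x) (vapp f x')" using assms by (auto intro: D_mono)
  show "le k B (vapp f x') (vapp f' x')" using assms by auto
qed (use assms in \<open>auto intro: D_app\<close>)

lemma sem_le_0:
  "typed \<Gamma> M A \<Longrightarrow> env_le 0 \<Gamma> \<nu> \<nu>' \<Longrightarrow> sem 0 \<nu> M \<in> D 0 A \<and> le 0 A (sem 0 \<nu> M) (sem 0 \<nu>' M)"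
proof (induction arbitrary: \<nu> \<nu>' rule: has_type.induct)
  case (1 i \<Gamma>)
  then show ?case by (simp add: env_le_def)
next
  case (2 c A \<Gamma>)
  then show ?case using const_interp_D0 le_refl by simp
next
  case (3 \<Gamma> A)
  have "vlam (D 0 (A \<rightarrow> A)) (fixp \<A> 0 A) \<in> D 0 ((A \<rightarrow> A) \<rightarrow> A)"
    by (rule vlam_D0) (use fixp_properties in blast)+
  then show ?case using le_refl by (simp del: leq.simps fixp.simps)
next
  case (4 A \<Gamma> M B)
  have "sem 0 (x # \<nu>) M \<in> D 0 B \<and> le 0 B (sem 0 (x # \<nu>) M) (sem 0 (y # \<nu>) M)"
    if "x \<in> D 0 A" "y \<in> D 0 A" "le 0 A x y" for x y
    using 4(2)[of "x # \<nu>" "y # \<nu>"] that env_le_refl[OF 4(3)] by (simp add: env_le_Cons)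
  then have "vlam (D 0 A) (\<lambda>p. sem 0 (p # \<nu>) M) \<in> D 0 (A \<rightarrow> B)"
    using le_refl by (intro vlam_D0) blast+
  moreover have "le 0 B (sem 0 (p # \<nu>) M) (sem 0 (p # \<nu>') M)" if "p \<in> D 0 A" for p
    using 4(2)[of "p # \<nu>" "p # \<nu>'"] 4(3) that by (auto simp: env_le_Cons le_refl)
  ultimately show ?case by simp
next
  case (5 \<Gamma> M A B N)
  show ?case
    using 5(3)[OF 5(5)] 5(4)[OF 5(5)] 5(3)[of \<nu>' \<nu>'] 5(4)[of \<nu>' \<nu>'] env_le_refl[OF 5(5)]
    by (auto intro: D_app app_le simp del: leq.simps)
qed

text \<open>An abstraction lies in \<open>D (Suc k)\<close> only if it is monotone and related to a
  function one level down, so both properties are proved in the same induction, given membership at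
  level \<open>k\<close>.\<close>

lemma sem_L_aux:
  assumes "\<forall>\<Gamma> M A \<nu>. typed \<Gamma> M A \<longrightarrow> env_le k \<Gamma> \<nu> \<nu> \<longrightarrow> sem k \<nu> M \<in> D k A"
  shows "typed \<Gamma> M A \<Longrightarrow> env_L k \<Gamma> \<mu> \<nu> \<Longrightarrow> env_L k \<Gamma> \<mu>' \<nu>' \<Longrightarrow> env_le (Suc k) \<Gamma> \<nu> \<nu>' \<Longrightarrow>
    (sem k \<mu> M, sem (Suc k) \<nu> M) \<in> L k A \<and> le (Suc k) A (sem (Suc k) \<nu> M) (sem (Suc k) \<nu>' M)"
proof (induction arbitrary: \<mu> \<mu>' \<nu> \<nu>' rule: has_type.induct)
  case (1 i \<Gamma>)
  then show ?case by (simp add: env_le_def env_L_def)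
next
  case (2 c A \<Gamma>)
  have "const_interp \<A> k c \<in> D k A"
    using assms[rule_format, OF has_type.intros(2)[of "signature \<A>" c A "[]"], of "[]"] 2(1) by (simp add: env_le_def)
  from const_interp_L[OF 2(1) this] show ?case using le_refl L_D by simp
next
  case (3 \<Gamma> A)
  have Y: "vlam (D k (A \<rightarrow> A)) (fixp \<A> k A) \<in> D k ((A \<rightarrow> A) \<rightarrow> A)"
    using assms[rule_format, OF has_type.intros(3)[of _ "[]"], of "[]"] by (simp add: env_le_def)
  have "(sem k \<mu> (Y A), sem (Suc k) \<nu> (Y A)) \<in> L k ((A \<rightarrow> A) \<rightarrow> A)"
    unfolding interp.simps
  proof (rule L_vlam[OF Y])
    fix f g assume fg: "(f, g) \<in> L k (A \<rightarrow> A)"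
    show "(fixp \<A> k A f, fixp \<A> (Suc k) A g) \<in> L k A"
      unfolding L_dn[OF fg] using fixp_properties[OF L_D(2)[OF fg]] by blast
  qed (use fixp_properties in blast)
  then show ?case using le_refl L_D(2) by (simp del: leq.simps)
next
  case (4 A \<Gamma> M B)
  have \<mu>: "env_le k \<Gamma> \<mu> \<mu>" using 4(3) by (auto simp: env_le_def env_L_def le_refl L_D)
  have refl: "env_le (Suc k) \<Gamma> \<nu> \<nu>" using env_le_refl[OF 4(5)] by blast
  have "(sem k \<mu> (Lam A M), sem (Suc k) \<nu> (Lam A M)) \<in> L k (A \<rightarrow> B)"
    unfolding interp.simps
  proof (rule L_vlam)
    show "vlam (D k A) (\<lambda>p. sem k (p # \<mu>) M) \<in> D k (A \<rightarrow> B)"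
      using assms[rule_format, OF has_type.intros(4)[OF 4(1)] \<mu>] by simp
    show "(sem k (x # \<mu>) M, sem (Suc k) (y # \<nu>) M) \<in> L k B" if "(x, y) \<in> L k A" for x y
      using 4(2)[of "x # \<mu>" "y # \<nu>" "x # \<mu>" "y # \<nu>"] that 4(3) refl L_D[OF that]
      by (auto simp: env_L_Cons env_le_Cons le_refl)
    show "le (Suc k) B (sem (Suc k) (x # \<nu>) M) (sem (Suc k) (y # \<nu>) M)"
      if "x \<in> D (Suc k) A" "y \<in> D (Suc k) A" "le (Suc k) A x y" for x y
      \<comment> \<open>The induction hypothesis asks for a lower environment under each upper one;
        \<open>dn\<close> supplies the new entries.\<close>
      using 4(2)[of "dn k A x # \<mu>" "x # \<nu>" "dn k A y # \<mu>" "y # \<nu>"] that 4(3) refl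
      by (auto simp: env_L_Cons env_le_Cons dn_L)
  qed
  moreover have "le (Suc k) B (sem (Suc k) (p # \<nu>) M) (sem (Suc k) (p # \<nu>') M)" if "p \<in> D (Suc k) A" for p
    using 4(2)[of "dn k A p # \<mu>" "p # \<nu>" "dn k A p # \<mu>'" "p # \<nu>'"] that 4(3-5)
    by (auto simp: env_L_Cons env_le_Cons dn_L le_refl)
  ultimately show ?case by simp
next
  case (5 \<Gamma> M A B N)
  note M = 5(3)[OF 5(5-7)] 5(3)[OF 5(6,6) conjunct2[OF env_le_refl[OF 5(7)]]]
  note N = 5(4)[OF 5(5-7)] 5(4)[OF 5(6,6) conjunct2[OF env_le_refl[OF 5(7)]]]
  have "(vapp (sem k \<mu> M) (sem k \<mu> N), vapp (sem (Suc k) \<nu> M) (sem (Suc k) \<nu> N)) \<in> L k B"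
    using L_app M(1) N(1) by blast
  moreover have "le (Suc k) B (vapp (sem (Suc k) \<nu> M) (sem (Suc k) \<nu> N)) (vapp (sem (Suc k) \<nu>' M) (sem (Suc k) \<nu>' N))"
    using app_le[of "sem (Suc k) \<nu> M" "Suc k" A B "sem (Suc k) \<nu>' M" "sem (Suc k) \<nu> N" "sem (Suc k) \<nu>' N"]
      M N L_D(2) by blast
  ultimately show ?case by simp
qed

lemma sem_D: "typed \<Gamma> M A \<Longrightarrow> env_le k \<Gamma> \<nu> \<nu> \<Longrightarrow> sem k \<nu> M \<in> D k A"
proof (induction k arbitrary: \<Gamma> M A \<nu>)
  case 0
  then show ?case using sem_le_0 by blast
next
  case (Suc k)
  \<comment> \<open>Restricting every entry yields a lower environment related to the arbitrary
    upper one.\<close>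
  let ?\<mu> = "map (\<lambda>i. dn k (\<Gamma> ! i) (\<nu> ! i)) [0..<length \<Gamma>]"
  have "env_L k \<Gamma> ?\<mu> \<nu>" using Suc.prems(2) by (auto simp: env_L_def env_le_def dn_L)
  with sem_L_aux[of k \<Gamma> M A ?\<mu> \<nu> ?\<mu> \<nu>] Suc show ?case using L_D(2) by blast
qed

lemma sem_L: "typed \<Gamma> M A \<Longrightarrow> env_L k \<Gamma> \<mu> \<nu> \<Longrightarrow> (sem k \<mu> M, sem (Suc k) \<nu> M) \<in> L k A"
proof -
  assume "typed \<Gamma> M A" and L: "env_L k \<Gamma> \<mu> \<nu>"
  moreover from L have "env_le (Suc k) \<Gamma> \<nu> \<nu>"
    using le_refl L_D(2) unfolding env_le_def env_L_def by blast
  ultimately show ?thesis using sem_L_aux[of k \<Gamma> M A \<mu> \<nu> \<mu> \<nu>] sem_D by blast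
qed

lemma sem_closed_D: "typed [] M A \<Longrightarrow> sem k [] M \<in> D k A"
  using sem_D by (simp add: env_le_def)

lemma sem_closed_L: "typed [] M A \<Longrightarrow> (sem k [] M, sem (Suc k) [] M) \<in> L k A"
  using sem_L by (simp add: env_L_def)

lemma sem_closed_the_set: "typed [] M \<o> \<Longrightarrow> sem k [] M = VSet (the_set (sem k [] M)) \<and> the_set (sem k [] M) \<subseteq> Qle k"
  using sem_closed_D[of M \<o> k] by auto

section \<open>Soundness of reduction\<close>

lemma sem_lift: "sem k (\<nu> @ d # \<nu>') (lift (length \<nu>) M) = sem k (\<nu> @ \<nu>') M"
proof (induction M arbitrary: \<nu>)
  case (Lam A M)
  then show ?case using Lam[of "_ # \<nu>"] by simp
qed (auto simp: nth_append Suc_diff_le)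

lemma sem_subst:
  "sem k (\<nu> @ \<nu>') (subst M N (length \<nu>)) = sem k (\<nu> @ sem k (\<nu> @ \<nu>') N # \<nu>') M"
proof (induction M arbitrary: \<nu> N)
  case (Lam A M)
  have "sem k (p # \<nu> @ \<nu>') (subst M (lift 0 N) (Suc (length \<nu>))) = sem k (p # \<nu> @ sem k (\<nu> @ \<nu>') N # \<nu>') M" for p
    using Lam[of "p # \<nu>" "lift 0 N"] sem_lift[of k "[]" p "\<nu> @ \<nu>'" N] by simp
  then show ?case by simp
qed (auto simp: nth_append nth_Cons')

text \<open>\<open>vapp (vlam X f) x\<close> equals \<open>f x\<close> for \<open>x\<close> in
  \<open>X\<close>, so beta is sound because typing places the value of the argument in the domain.
  Delta is the fixpoint equation of \<open>fixp\<close>.\<close>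

lemma sem_red: "red M M' \<Longrightarrow> typed \<Gamma> M A \<Longrightarrow> env_le k \<Gamma> \<nu> \<nu> \<Longrightarrow> sem k \<nu> M = sem k \<nu> M'"
proof (induction arbitrary: \<Gamma> A \<nu> rule: red.induct)
  case (beta B M N)
  then have "typed \<Gamma> N B" by (auto elim!: has_type_AppE has_type_LamE)
  from sem_D[OF this beta(2)] show ?case using sem_subst[of k "[]" \<nu> M N] by simp
next
  case (delta B M)
  then have "typed \<Gamma> M (B \<rightarrow> B)" by (auto elim!: has_type_AppE has_type_YE)
  from sem_D[OF this delta(2)] show ?case using fixp_properties by simp
next
  fix M M' :: "'c tm" and B \<Gamma> A \<nu>
  assume IH: "\<And>\<Gamma> A \<nu>. typed \<Gamma> M A \<Longrightarrow> env_le k \<Gamma> \<nu> \<nu> \<Longrightarrow> sem k \<nu> M = sem k \<nu> M'"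
    and "typed \<Gamma> (Lam B M) A" "env_le k \<Gamma> \<nu> \<nu>"
  then obtain C where "typed (B # \<Gamma>) M C" by (auto elim: has_type_LamE)
  from IH[OF this] \<open>env_le k \<Gamma> \<nu> \<nu>\<close> show "sem k \<nu> (Lam B M) = sem k \<nu> (Lam B M')"
    by (auto intro!: vlam_cong simp: env_le_Cons le_refl)
qed (auto elim!: has_type_AppE)

lemma sem_reds: "red\<^sup>*\<^sup>* M M' \<Longrightarrow> typed [] M A \<Longrightarrow> sem k [] M = sem k [] M'"
  by (induction rule: rtranclp_induct)
    (auto simp: env_le_def dest: sem_red[where \<nu> = "[]" and \<Gamma> = "[]"] has_type_reds)

lemma sem_weaken: "typed \<Gamma> M A \<Longrightarrow> length \<nu> = length \<Gamma> \<Longrightarrow> sem k (\<nu> @ \<nu>') M = sem k \<nu> M"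
proof (induction arbitrary: \<nu> rule: has_type.induct)
  case (4 A \<Gamma> M B)
  then show ?case using 4(2)[of "_ # \<nu>"] by simp
qed (auto simp: nth_append)

lemma sem_csubst:
  assumes "typed (\<Gamma> @ \<Delta>) M A" "list_all2 (typed []) Ns \<Delta>" "length \<nu> = length \<Gamma>"
  shows "sem k \<nu> (csubst (length \<Gamma>) Ns M) = sem k (\<nu> @ map (sem k []) Ns) M"
  using assms
proof (induction "\<Gamma> @ \<Delta>" M A arbitrary: \<Gamma> \<nu> rule: has_type.induct)
  case (1 i)
  show ?case
  proof (cases "i < length \<Gamma>")
    case False
    with 1 have i: "i - length \<Gamma> < length Ns" "typed [] (Ns ! (i - length \<Gamma>)) (\<Delta> ! (i - length \<Gamma>))"
      by (auto simp: list_all2_conv_all_nth)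
    from sem_weaken[OF i(2), of "[]" k \<nu>] False 1(3) i(1) show ?thesis by (simp add: nth_append)
  qed (use 1 in \<open>simp add: nth_append\<close>)
next
  case (4 A M B)
  then show ?case using 4(2)[of "A # \<Gamma>" "_ # \<nu>"] by simp
qed auto

section \<open>The winning region of the acceptance game\<close>

text \<open>One choice of Eve and one of Adam, with \<open>Z\<close> for the pairs won afterwards. A
  position becomes the tree below its node and its state, as the rest of the game depends on nothing
  else. The label must have binary type, which \<open>move\<close> does not check, so that weakness
  applies.\<close>

definition locally_won :: "('c btree \<times> 'q) set \<Rightarrow> 'c btree \<Rightarrow> 'q \<Rightarrow> bool" where
  "locally_won Z t q \<longleftrightarrow>
     (\<exists>c. t = BNode [] (HConst c) [] \<and> delta0 \<A> q c \<noteq> {}) \<or>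
     (t = BOmega \<and> even (rank \<A> q)) \<or>
     (\<exists>a t0 t1 S0 S1. t = BNode [] (HConst a) [t0, t1] \<and> signature \<A> a = Some (\<o> \<rightarrow> \<o> \<rightarrow> \<o>) \<and>
        (S0, S1) \<in> delta2 \<A> q a \<and> (\<forall>q' \<in> S0. (t0, q') \<in> Z) \<and> (\<forall>q' \<in> S1. (t1, q') \<in> Z))"

definition layer_step :: "nat \<Rightarrow> ('c btree \<times> 'q) set \<Rightarrow> ('c btree \<times> 'q) set \<Rightarrow> ('c btree \<times> 'q) set" where
  "layer_step k Z X = {(t, q). q \<in> states \<A> \<and> rank \<A> q = k \<and> locally_won (X \<union> Z) t q}"

definition layer :: "nat \<Rightarrow> ('c btree \<times> 'q) set \<Rightarrow> ('c btree \<times> 'q) set" where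
  "layer k Z = (if even k then gfp (layer_step k Z) else lfp (layer_step k Z))"

text \<open>\<open>region k\<close> collects the pairs of a tree and a state of rank below \<open>k\<close> from which Eve wins.\<close>

primrec region :: "nat \<Rightarrow> ('c btree \<times> 'q) set" where
  "region 0 = {}"
| "region (Suc k) = region k \<union> layer k (region k)"

lemma locally_won_mono: "Z \<subseteq> Z' \<Longrightarrow> locally_won Z t q \<Longrightarrow> locally_won Z' t q"
  unfolding locally_won_def by blast

lemma mono_layer_step: "mono (layer_step k Z)"
  unfolding layer_step_def by (rule monoI) (auto elim: locally_won_mono[rotated])

lemma layer_unfold: "layer k Z = layer_step k Z (layer k Z)"
  unfolding layer_def using gfp_unfold[OF mono_layer_step] lfp_unfold[OF mono_layer_step] by metis

lemma layer_rank: "(t, q) \<in> layer k Z \<Longrightarrow> q \<in> states \<A> \<and> rank \<A> q = k"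
  by (subst (asm) layer_unfold) (auto simp: layer_step_def)

lemma region_rank: "(t, q) \<in> region k \<Longrightarrow> q \<in> states \<A> \<and> rank \<A> q < k"
  by (induction k) (auto dest: layer_rank)

text \<open>By weakness the successor states never have higher rank than \<open>q\<close>, so only
  that part of \<open>Z\<close> is consulted.\<close>

lemma locally_won_cong:
  assumes q: "q \<in> states \<A>" and eq: "\<And>t q'. rank \<A> q' \<le> rank \<A> q \<Longrightarrow> (t, q') \<in> Z \<longleftrightarrow> (t, q') \<in> Z'"
  shows "locally_won Z t q \<longleftrightarrow> locally_won Z' t q"
proof -
  have "(\<forall>q' \<in> S0. (t0, q') \<in> Z) \<and> (\<forall>q' \<in> S1. (t1, q') \<in> Z) \<longleftrightarrow>
      (\<forall>q' \<in> S0. (t0, q') \<in> Z') \<and> (\<forall>q' \<in> S1. (t1, q') \<in> Z')"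
    if "signature \<A> a = Some (\<o> \<rightarrow> \<o> \<rightarrow> \<o>)" "(S0, S1) \<in> delta2 \<A> q a" for a S0 S1 t0 t1
  proof -
    have "rank \<A> q' \<le> rank \<A> q" if "q' \<in> S0 \<union> S1" for q'
      using delta2_weak[OF q \<open>signature \<A> a = _\<close> \<open>(S0, S1) \<in> _\<close>] that by (auto simp: Q_le_def)
    then show ?thesis using eq by blast
  qed
  then show ?thesis unfolding locally_won_def by (smt (verit, best))
qed

lemma region_layer: "rank \<A> q = k \<Longrightarrow> (t, q) \<in> region (Suc k) \<longleftrightarrow> (t, q) \<in> layer k (region k)"
  using region_rank by fastforce

text \<open>Higher layers do not disturb lower ones, so the union of the layers built so far
  satisfies the one-step equation of the game as a whole.\<close>

lemma region_iff:
  "(t, q) \<in> region k \<longleftrightarrow> q \<in> states \<A> \<and> rank \<A> q < k \<and> locally_won (region k) t q"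
proof (induction k)
  case (Suc k)
  consider "rank \<A> q < k" | "rank \<A> q = k" | "rank \<A> q > k" by linarith
  then show ?case
  proof cases
    case 1
    then have "(t', q') \<in> region k \<longleftrightarrow> (t', q') \<in> region (Suc k)" if "rank \<A> q' \<le> rank \<A> q" for t' q'
      using that layer_rank by fastforce
    then have "locally_won (region k) t q \<longleftrightarrow> locally_won (region (Suc k)) t q" if "q \<in> states \<A>"
      using locally_won_cong[OF that, of "region k" "region (Suc k)" t] by blast
    with 1 Suc show ?thesis using layer_rank by fastforce
  next
    case 2
    have "(t, q) \<in> layer k (region k) \<longleftrightarrow> (t, q) \<in> layer_step k (region k) (layer k (region k))"
      using layer_unfold by metis
    then show ?thesis unfolding region_layer[OF 2]
      using 2 by (simp add: layer_step_def Un_commute)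
  qed (use region_rank[of t q "Suc k"] in auto)
qed simp

lemma region_rank_iff: "(t, q) \<in> region k \<longleftrightarrow> rank \<A> q < k \<and> (t, q) \<in> region (Suc (rank \<A> q))"
proof (induction k)
  case (Suc k)
  consider "rank \<A> q < k" | "rank \<A> q = k" | "rank \<A> q > k" by linarith
  then show ?case
  proof cases
    case 1
    then have "(t, q) \<notin> layer k (region k)" using layer_rank by blast
    with 1 Suc show ?thesis by simp
  qed (use region_rank[of t q "Suc k"] in auto)
qed simp

text \<open>Since a node has finitely many successor states, least fixpoints are reached after finitely
  many steps at every point; the number of steps is a progress measure for Eve.\<close>

definition stage :: "nat \<Rightarrow> nat \<Rightarrow> ('c btree \<times> 'q) set" where
  "stage k n = (layer_step k (region k) ^^ n) {}"

lemma stage_Suc: "stage k (Suc n) = layer_step k (region k) (stage k n)"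
  by (simp add: stage_def)

lemma stage_mono: "m \<le> n \<Longrightarrow> stage k m \<subseteq> stage k n"
proof -
  have "stage k n \<subseteq> stage k (Suc n)" for n
  proof (induction n)
    case (Suc n)
    then show ?case unfolding stage_Suc[of k "Suc n"] stage_Suc[of k n] by (rule monoD[OF mono_layer_step])
  qed (simp add: stage_def)
  then show "m \<le> n \<Longrightarrow> stage k m \<subseteq> stage k n" by (rule lift_Suc_mono_le)
qed

lemma odd_layer_stages:
  assumes "odd k"
  shows "layer k (region k) \<subseteq> (\<Union>n. stage k n)"
proof -
  have "layer_step k (region k) (\<Union>n. stage k n) \<subseteq> (\<Union>n. stage k n)"
  proof safe
    fix t q assume "(t, q) \<in> layer_step k (region k) (\<Union>n. stage k n)"
    then have q: "q \<in> states \<A>" "rank \<A> q = k" and won: "locally_won ((\<Union>n. stage k n) \<union> region k) t q"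
      by (auto simp: layer_step_def)
    have "\<exists>n. locally_won (stage k n \<union> region k) t q"
    proof -
      consider "\<And>Z. locally_won Z t q" | a t0 t1 S0 S1 where "t = BNode [] (HConst a) [t0, t1]"
          "signature \<A> a = Some (\<o> \<rightarrow> \<o> \<rightarrow> \<o>)" "(S0, S1) \<in> delta2 \<A> q a"
          "\<forall>q' \<in> S0. (t0, q') \<in> (\<Union>n. stage k n) \<union> region k"
          "\<forall>q' \<in> S1. (t1, q') \<in> (\<Union>n. stage k n) \<union> region k"
        using won unfolding locally_won_def by blast
      then show ?thesis
      proof cases
        case 2
        have bound: "\<exists>n. \<forall>q' \<in> S. (t', q') \<in> stage k n \<union> region k"
          if "finite S" "\<forall>q' \<in> S. (t', q') \<in> (\<Union>n. stage k n) \<union> region k" for S t'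
          using that
        proof (induction rule: finite_induct)
          case (insert x F)
          then obtain n m where "\<forall>q' \<in> F. (t', q') \<in> stage k n \<union> region k" "(t', x) \<in> stage k m \<union> region k"
            by blast
          then show ?case
            using stage_mono[of n "max n m" k] stage_mono[of m "max n m" k]
            by (intro exI[of _ "max n m"]) auto
        qed simp
        have "finite S0" "finite S1"
          using delta2_weak[OF q(1) 2(2,3)] finite_subset[OF _ finite_Qle] by blast+
        then obtain n m where "\<forall>q' \<in> S0. (t0, q') \<in> stage k n \<union> region k"
            "\<forall>q' \<in> S1. (t1, q') \<in> stage k m \<union> region k"
          using bound 2(4,5) by metis
        then have "\<forall>q' \<in> S0. (t0, q') \<in> stage k (max n m) \<union> region k"
            "\<forall>q' \<in> S1. (t1, q') \<in> stage k (max n m) \<union> region k"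
          using stage_mono[of n "max n m" k] stage_mono[of m "max n m" k] by auto
        with 2(1-3) show ?thesis unfolding locally_won_def by blast
      qed blast
    qed
    then obtain n where "(t, q) \<in> stage k (Suc n)" using q by (auto simp: stage_Suc layer_step_def)
    then show "(t, q) \<in> (\<Union>n. stage k n)" by blast
  qed
  then show ?thesis using assms by (simp add: layer_def lfp_lowerbound)
qed

text \<open>Meaningful on odd layers. Stages are taken at the rank of the state itself, since
  progress is compared only between states of equal rank.\<close>

definition progress :: "'c btree \<Rightarrow> 'q \<Rightarrow> nat" where
  "progress t q = (LEAST n. (t, q) \<in> stage (rank \<A> q) n)"

text \<open>In odd rank Eve plays the witness from the first stage containing the pair, so each
  successor has lower rank or occurs at an earlier stage. In even rank any witness of the one-step
  equation will do.\<close>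

lemma region_node:
  assumes win: "(BNode [] (HConst a) [t0, t1], q) \<in> region (Suc (rank \<A> q))"
  shows "\<exists>S0 S1. (S0, S1) \<in> delta2 \<A> q a \<and>
    (\<forall>(t', S) \<in> {(t0, S0), (t1, S1)}. \<forall>q' \<in> S. (t', q') \<in> region (Suc (rank \<A> q')) \<and> rank \<A> q' \<le> rank \<A> q \<and>
       (odd (rank \<A> q) \<and> rank \<A> q' = rank \<A> q \<longrightarrow> progress t' q' < progress (BNode [] (HConst a) [t0, t1]) q))"
    (is "\<exists>S0 S1. _ \<and> (\<forall>(t', S) \<in> _. \<forall>q' \<in> S. ?P t' q')")
proof -
  let ?t = "BNode [] (HConst a) [t0, t1]" and ?k = "rank \<A> q"
  have q: "q \<in> states \<A>" using win region_rank by blast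
  show ?thesis
  proof (cases "odd ?k")
    case True
    have "(?t, q) \<in> layer ?k (region ?k)" using win region_layer by blast
    then have ex: "\<exists>n. (?t, q) \<in> stage ?k n" using odd_layer_stages[OF True] by blast
    then have least: "(?t, q) \<in> stage ?k (progress ?t q)" unfolding progress_def by (rule LeastI_ex)
    \<comment> \<open>Stage 0 is empty, so the first stage containing the pair is a
      successor.\<close>
    then obtain n where n: "progress ?t q = Suc n" by (cases "progress ?t q") (auto simp: stage_def)
    have "locally_won (stage ?k n \<union> region ?k) ?t q"
      using least unfolding n stage_Suc by (simp add: layer_step_def)
    then obtain S0 S1 where S: "signature \<A> a = Some (\<o> \<rightarrow> \<o> \<rightarrow> \<o>)" "(S0, S1) \<in> delta2 \<A> q a"
        "\<forall>q' \<in> S0. (t0, q') \<in> stage ?k n \<union> region ?k" "\<forall>q' \<in> S1. (t1, q') \<in> stage ?k n \<union> region ?k"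
      unfolding locally_won_def by blast
    have stage_layer: "stage ?k m \<subseteq> layer ?k (region ?k)" for m
    proof (induction m)
      case (Suc m)
      then show ?case unfolding stage_Suc
        by (subst layer_unfold) (rule monoD[OF mono_layer_step])
    qed (simp add: stage_def)
    have "?P t' q'" if *: "(t', q') \<in> stage ?k n \<union> region ?k" for t' q'
    proof (cases "(t', q') \<in> region ?k")
      case True
      then show ?thesis using region_rank region_rank_iff by (metis less_imp_le less_irrefl)
    next
      case False
      with * have st: "(t', q') \<in> stage ?k n" by blast
      then have k: "rank \<A> q' = ?k" using stage_layer layer_rank by blast
      then have "progress t' q' \<le> n" unfolding progress_def using st by (metis Least_le)
      moreover have "(t', q') \<in> region (Suc ?k)" using st stage_layer by auto
      ultimately show ?thesis using k n by simp
    qed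
    with S(2-4) show ?thesis by blast
  next
    case False
    have "locally_won (region (Suc ?k)) ?t q" using win region_iff by blast
    then obtain S0 S1 where S: "(S0, S1) \<in> delta2 \<A> q a"
        "\<forall>q' \<in> S0. (t0, q') \<in> region (Suc ?k)" "\<forall>q' \<in> S1. (t1, q') \<in> region (Suc ?k)"
      unfolding locally_won_def by blast
    have "?P t' q'" if "(t', q') \<in> region (Suc ?k)" for t' q'
      using that False region_rank region_rank_iff by (metis less_Suc_eq_le)
    with S show ?thesis by blast
  qed
qed

section \<open>Acceptance coincides with the winning region\<close>

text \<open>Weakness is assumed only for constants of binary type; on these trees it therefore
  bounds every pair of sets that Eve can pick.\<close>

definition binary_labelled :: "'c btree \<Rightarrow> bool" where
  "binary_labelled t \<longleftrightarrow> (\<forall>v a t0 t1. subtree t v = Some (BNode [] (HConst a) [t0, t1]) \<longrightarrow>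
     signature \<A> a = Some (\<o> \<rightarrow> \<o> \<rightarrow> \<o>))"

lemma subtree_snoc: "subtree t v = Some (BNode As h ts) \<Longrightarrow> j < length ts \<Longrightarrow> subtree t (v @ [j]) = Some (ts ! j)"
  by (induction v arbitrary: t) (auto split: btree.splits if_splits)

lemma history_nonempty: "history \<A> t q \<sigma> h \<Longrightarrow> h \<noteq> []"
  by (induction rule: history.induct) auto

lemma history_snocD:
  assumes "history \<A> t q \<sigma> (h @ [p])" "h \<noteq> []"
  shows "history \<A> t q \<sigma> h \<and> move \<A> t (last h) p \<and> (\<forall>v r. last h = EveAt v r \<longrightarrow> p = \<sigma> h)"
  using assms by (cases rule: history.cases) auto

lemma history_take: "history \<A> t q \<sigma> h \<Longrightarrow> n < length h \<Longrightarrow> history \<A> t q \<sigma> (take (Suc n) h)"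
proof (induction h rule: rev_induct)
  case (snoc p h)
  show ?case
  proof (cases "n < length h")
    case True
    then have "h \<noteq> []" by auto
    with snoc True history_snocD[OF snoc.prems(1)] show ?thesis by simp
  next
    case False
    with snoc.prems show ?thesis by simp
  qed
qed simp

inductive_cases move_EveE: "move \<A> t (EveAt v r) p"
inductive_cases move_AdamE: "move \<A> t (AdamAt v S0 S1) p"

text \<open>Eve follows \<open>region_node\<close> at every node. Ranks never increase along a play,
  hence stabilize, and an odd eventual rank would let \<open>progress\<close> descend
  forever.\<close>

lemma accepts_if_region:
  assumes win: "(t, q) \<in> region (Suc (rank \<A> q))"
  shows "accepts \<A> t q"
proof -
  define w where "w v r \<longleftrightarrow> (\<exists>t'. subtree t v = Some t' \<and> (t', r) \<in> region (Suc (rank \<A> r)))" for v r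
  define pr where "pr v r = progress (the (subtree t v)) r" for v r
  define good where "good v r S0 S1 \<longleftrightarrow>
    (\<forall>(j, S) \<in> {(0, S0), (1, S1)}. \<forall>q' \<in> S. w (v @ [j]) q' \<and> rank \<A> q' \<le> rank \<A> r \<and>
      (odd (rank \<A> r) \<and> rank \<A> q' = rank \<A> r \<longrightarrow> pr (v @ [j]) q' < pr v r))" for v r S0 S1
  \<comment> \<open>The second branch is a dummy value, as a strategy is consulted only at positions
    of Eve.\<close>
  define \<sigma> where "\<sigma> h = (case last h of
      EveAt v r \<Rightarrow> (SOME p. \<exists>S0 S1. p = AdamAt v S0 S1 \<and> move \<A> t (EveAt v r) p \<and> good v r S0 S1)
    | AdamAt v S0 S1 \<Rightarrow> AdamAt v S0 S1)" for h :: "'q position list"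
  have choose: "\<exists>S0 S1. \<sigma> h = AdamAt v S0 S1 \<and> move \<A> t (EveAt v r) (\<sigma> h) \<and> good v r S0 S1"
    if h: "last h = EveAt v r" and "w v r" and "move \<A> t (EveAt v r) p" for h v r p
  proof -
    from that(3) obtain a t0 t1 where node: "subtree t v = Some (BNode [] (HConst a) [t0, t1])"
      by (auto elim: move_EveE)
    with \<open>w v r\<close> have "(BNode [] (HConst a) [t0, t1], r) \<in> region (Suc (rank \<A> r))" by (simp add: w_def)
    from region_node[OF this] obtain S0 S1 where S: "(S0, S1) \<in> delta2 \<A> r a"
      "\<forall>(t', S) \<in> {(t0, S0), (t1, S1)}. \<forall>q' \<in> S. (t', q') \<in> region (Suc (rank \<A> q')) \<and> rank \<A> q' \<le> rank \<A> r \<and>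
       (odd (rank \<A> r) \<and> rank \<A> q' = rank \<A> r \<longrightarrow> progress t' q' < progress (BNode [] (HConst a) [t0, t1]) r)"
      by blast
    have "subtree t (v @ [0]) = Some t0" "subtree t (v @ [1]) = Some t1"
      using subtree_snoc[OF node, of 0] subtree_snoc[OF node, of 1] by auto
    with S(2) node have "good v r S0 S1" by (auto simp: good_def w_def pr_def)
    moreover have "move \<A> t (EveAt v r) (AdamAt v S0 S1)" using node S(1) by (rule move.intros)
    ultimately have "\<exists>p S0 S1. p = AdamAt v S0 S1 \<and> move \<A> t (EveAt v r) p \<and> good v r S0 S1" by blast
    from someI_ex[OF this] show ?thesis by (simp add: \<sigma>_def h)
  qed
  \<comment> \<open>\<open>AdamAt\<close> does not record the state from which Eve moved, so the
    invariant only asserts that a suitable \<open>r\<close> exists.\<close>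
  have inv: "case last h of EveAt v r \<Rightarrow> w v r | AdamAt v S0 S1 \<Rightarrow> \<exists>r. good v r S0 S1"
    if "history \<A> t q \<sigma> h" for h
    using that
  proof (induction rule: history.induct)
    case 1
    show ?case using win by (simp add: w_def)
  next
    case (2 h v r)
    then have "w v r" by simp
    from choose[OF 2(2) this 2(3)] show ?case by auto
  next
    case (3 h v S0 S1 p)
    then show ?case by (auto elim!: move_AdamE simp: good_def)
  qed
  have "winning_strategy \<A> t q \<sigma>"
    unfolding winning_strategy_def
  proof (intro conjI allI impI)
    fix h v r assume "history \<A> t q \<sigma> h" "last h = EveAt v r" "\<exists>p. move \<A> t (EveAt v r) p"
    with choose inv[of h] show "move \<A> t (EveAt v r) (\<sigma> h)" by fastforce
  next
    fix h assume h: "history \<A> t q \<sigma> h" and stuck: "\<nexists>p. move \<A> t (last h) p"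
    show "eve_wins_stuck \<A> t (last h)"
    proof (cases "last h")
      case (EveAt v r)
      with inv[OF h] obtain t' where t': "subtree t v = Some t'" "(t', r) \<in> region (Suc (rank \<A> r))"
        by (auto simp: w_def)
      have "locally_won (region (Suc (rank \<A> r))) t' r" using t'(2) region_iff by blast
      then show ?thesis
        unfolding EveAt using stuck t'(1) by (auto simp: EveAt locally_won_def intro: move.intros)
    qed simp
  next
    fix \<pi> assume play: "infinite_play \<A> t q \<sigma> \<pi>"
    have hist: "history \<A> t q \<sigma> (map \<pi> [0..<Suc n])" for n using play by (simp add: infinite_play_def)
    have step: "move \<A> t (\<pi> n) (\<pi> (Suc n)) \<and> (\<forall>v r. \<pi> n = EveAt v r \<longrightarrow> \<pi> (Suc n) = \<sigma> (map \<pi> [0..<Suc n]))" for n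
      using history_snocD[of t q \<sigma> "map \<pi> [0..<Suc n]" "\<pi> (Suc n)"] hist[of "Suc n"] by simp
    have init: "\<pi> 0 = EveAt [] q"
      using hist[of 0] by (cases rule: history.cases) (auto dest: history_nonempty)
    have advance: "\<exists>v' r' S0 S1. \<pi> (Suc n) = AdamAt v S0 S1 \<and> \<pi> (Suc (Suc n)) = EveAt v' r' \<and> rank \<A> r' \<le> rank \<A> r \<and>
        (odd (rank \<A> r) \<and> rank \<A> r' = rank \<A> r \<longrightarrow> pr v' r' < pr v r)" if n: "\<pi> n = EveAt v r" for n v r
    proof -
      have "w v r" using inv[OF hist[of n]] n by simp
      moreover have "last (map \<pi> [0..<Suc n]) = EveAt v r" using n by simp
      ultimately obtain S0 S1 where S: "\<pi> (Suc n) = AdamAt v S0 S1" "good v r S0 S1"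
        using choose step[of n] n by metis
      from step[of "Suc n"] S show ?thesis by (auto elim!: move_AdamE simp: good_def)
    qed
    \<comment> \<open>Eve begins and the players alternate, so the even indices are her
      positions.\<close>
    have "\<exists>v r. \<pi> (2 * n) = EveAt v r" for n
      by (induction n) (use init advance in \<open>fastforce+\<close>)
    then obtain v r where eve: "\<And>n. \<pi> (2 * n) = EveAt (v n) (r n)" by metis
    have next_le: "rank \<A> (r (Suc n)) \<le> rank \<A> (r n)"
      and next_less: "odd (rank \<A> (r n)) \<Longrightarrow> rank \<A> (r (Suc n)) = rank \<A> (r n) \<Longrightarrow>
        pr (v (Suc n)) (r (Suc n)) < pr (v n) (r n)" for n
      using advance[OF eve[of n]] eve[of "Suc n"] by auto
    \<comment> \<open>A nonincreasing sequence of ranks is constant from any index where it attains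
      its minimum.\<close>
    obtain N where N: "\<And>n. rank \<A> (r N) \<le> rank \<A> (r n)"
      using ex_has_least_nat[of "\<lambda>_. True" 0 "\<lambda>n. rank \<A> (r n)"] by blast
    have const: "rank \<A> (r (N + n)) = rank \<A> (r N)" for n
    proof (induction n)
      case (Suc n)
      then show ?case using next_le[of "N + n"] N[of "Suc (N + n)"] by simp
    qed simp
    have "even (rank \<A> (r N))"
    proof (rule ccontr)
      assume odd: "odd (rank \<A> (r N))"
      have "pr (v (N + n)) (r (N + n)) + n \<le> pr (v N) (r N)" for n
      proof (induction n)
        case (Suc n)
        have "pr (v (Suc (N + n))) (r (Suc (N + n))) < pr (v (N + n)) (r (N + n))"
          using odd const[of n] const[of "Suc n"] by (intro next_less) auto
        with Suc show ?case by simp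
      qed simp
      from this[of "Suc (pr (v N) (r N))"] show False by simp
    qed
    moreover have "rank \<A> r' = rank \<A> (r N)" if "i \<ge> 2 * N" "\<pi> i = EveAt v' r'" for i v' r'
    proof (cases "even i")
      case True
      then obtain n where n: "i = 2 * n" by blast
      then show ?thesis using that eve[of n] const[of "n - N"] by simp
    next
      case False
      then obtain n where "i = Suc (2 * n)" by (auto elim: oddE)
      then show ?thesis using that advance[OF eve[of n]] by auto
    qed
    ultimately show "\<exists>n k. even k \<and> (\<forall>i \<ge> n. \<forall>v r. \<pi> i = EveAt v r \<longrightarrow> rank \<A> r = k)" by blast
  qed
  then show ?thesis unfolding accepts_def by blast
qed

text \<open>A strategy may depend on the whole history, so the induction on the rank reached speaks
  of histories. In even rank the pairs reached form a post-fixpoint. In odd rank, a history ending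
  outside the region could be prolonged forever in the same rank, and the strategy would lose that
  play.\<close>

lemma region_if_accepts:
  assumes "accepts \<A> t q" "q \<in> states \<A>" and t: "binary_labelled t"
  shows "(t, q) \<in> region (Suc (rank \<A> q))"
proof -
  from assms(1) obtain \<sigma> where \<sigma>: "winning_strategy \<A> t q \<sigma>" by (auto simp: accepts_def)
  let ?hist = "history \<A> t q \<sigma>"
  have inv: "case last h of EveAt v r \<Rightarrow> r \<in> states \<A> \<and> subtree t v \<noteq> None
    | AdamAt v S0 S1 \<Rightarrow> S0 \<subseteq> states \<A> \<and> S1 \<subseteq> states \<A> \<and> (\<exists>a t0 t1. subtree t v = Some (BNode [] (HConst a) [t0, t1]))"
    if "?hist h" for h
    using that
  proof (induction rule: history.induct)
    case (2 h v r)
    from 2(3) obtain a t0 t1 S0 S1 where *: "\<sigma> h = AdamAt v S0 S1"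
        "subtree t v = Some (BNode [] (HConst a) [t0, t1])" "(S0, S1) \<in> delta2 \<A> r a"
      by (auto elim: move_EveE)
    have "r \<in> states \<A>" using 2 by simp
    with delta2_weak[of r a S0 S1] t * have "S0 \<subseteq> states \<A>" "S1 \<subseteq> states \<A>"
      by (auto simp: binary_labelled_def Q_le_def)
    with * show ?case by simp
  next
    case (3 h v S0 S1 p)
    then obtain a t0 t1 where "subtree t v = Some (BNode [] (HConst a) [t0, t1])" by auto
    from subtree_snoc[OF this, of 0] subtree_snoc[OF this, of 1] 3 show ?case
      by (auto elim!: move_AdamE)
  qed (use assms(2) in simp)
  \<comment> \<open>Reads the strategy as a disjunct of \<open>locally_won\<close>: the play is
    stuck and won, or every reply of Adam to \<open>\<sigma> h\<close> gives a history
    again.\<close>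
  have step: "\<exists>t'. subtree t v = Some t' \<and> r \<in> states \<A> \<and> ((\<forall>Z. locally_won Z t' r) \<or>
      (\<exists>a t0 t1 S0 S1. t' = BNode [] (HConst a) [t0, t1] \<and> signature \<A> a = Some (\<o> \<rightarrow> \<o> \<rightarrow> \<o>) \<and> (S0, S1) \<in> delta2 \<A> r a \<and>
         subtree t (v @ [0]) = Some t0 \<and> subtree t (v @ [1]) = Some t1 \<and>
         (\<forall>q' \<in> S0. ?hist (h @ [\<sigma> h, EveAt (v @ [0]) q'])) \<and> (\<forall>q' \<in> S1. ?hist (h @ [\<sigma> h, EveAt (v @ [1]) q']))))"
    if h: "?hist h" and last: "last h = EveAt v r" for h v r
  proof -
    from inv[OF h] last obtain t' where r: "r \<in> states \<A>" and t': "subtree t v = Some t'" by auto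
    show ?thesis
    proof (cases "\<exists>p. move \<A> t (EveAt v r) p")
      case True
      then have mv: "move \<A> t (EveAt v r) (\<sigma> h)" using \<sigma> h last by (auto simp: winning_strategy_def)
      then obtain a t0 t1 S0 S1 where *: "\<sigma> h = AdamAt v S0 S1"
          "subtree t v = Some (BNode [] (HConst a) [t0, t1])" "(S0, S1) \<in> delta2 \<A> r a"
        by (auto elim: move_EveE)
      have h': "?hist (h @ [\<sigma> h])" using h last mv by (rule history.intros)
      have "?hist (h @ [\<sigma> h, EveAt (v @ [0]) q'])" if "q' \<in> S0" for q'
        using history.intros(3)[OF h' _ move.intros(2)[OF that]] *(1) by simp
      moreover have "?hist (h @ [\<sigma> h, EveAt (v @ [1]) q'])" if "q' \<in> S1" for q'
        using history.intros(3)[OF h' _ move.intros(3)[OF that]] *(1) by simp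
      moreover have "subtree t (v @ [0]) = Some t0" "subtree t (v @ [1]) = Some t1"
        using subtree_snoc[OF *(2), of 0] subtree_snoc[OF *(2), of 1] by auto
      moreover have "signature \<A> a = Some (\<o> \<rightarrow> \<o> \<rightarrow> \<o>)" using t *(2) unfolding binary_labelled_def by blast
      ultimately show ?thesis using r *(2,3) by blast
    next
      case False
      then have "eve_wins_stuck \<A> t (EveAt v r)"
        using \<sigma> h last unfolding winning_strategy_def by metis
      with r t' show ?thesis by (auto simp: locally_won_def)
    qed
  qed
  have "(t', r) \<in> region (Suc k)"
    if "?hist h" "last h = EveAt v r" "rank \<A> r = k" "subtree t v = Some t'" for k h v r t'
    using that
  proof (induction k arbitrary: h v r t' rule: less_induct)
    case (less k)
    have lower: "(t', r) \<in> region k"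
      if "?hist h" "last h = EveAt v r" "rank \<A> r < k" "subtree t v = Some t'" for h v r t'
      using less.IH[OF that(3,1,2) refl that(4)] region_rank_iff that(3) by blast
    show ?case
    proof (cases "even k")
      case True
      define X where "X = {(t', r). \<exists>h v. ?hist h \<and> last h = EveAt v r \<and> rank \<A> r = k \<and> subtree t v = Some t'}"
      have "X \<subseteq> layer_step k (region k) X"
      proof safe
        fix t' r assume "(t', r) \<in> X"
        then obtain h v where h: "?hist h" "last h = EveAt v r" "rank \<A> r = k" "subtree t v = Some t'"
          by (auto simp: X_def)
        have succ: "(t'', q') \<in> X \<union> region k"
          if "?hist (h @ [\<sigma> h, EveAt v' q'])" "rank \<A> q' \<le> k" "subtree t v' = Some t''" for v' q' t''
          using that lower[OF that(1)] unfolding X_def by (cases "rank \<A> q' < k") fastforce+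
        from step[OF h(1,2)] h(4) have r: "r \<in> states \<A>" by auto
        from step[OF h(1,2)] h(4) consider "\<forall>Z. locally_won Z t' r" |
          a t0 t1 S0 S1 where "t' = BNode [] (HConst a) [t0, t1]" "signature \<A> a = Some (\<o> \<rightarrow> \<o> \<rightarrow> \<o>)"
            "(S0, S1) \<in> delta2 \<A> r a" "subtree t (v @ [0]) = Some t0" "subtree t (v @ [1]) = Some t1"
            "\<forall>q' \<in> S0. ?hist (h @ [\<sigma> h, EveAt (v @ [0]) q'])" "\<forall>q' \<in> S1. ?hist (h @ [\<sigma> h, EveAt (v @ [1]) q'])"
          by auto
        then have "locally_won (X \<union> region k) t' r"
        proof cases
          case 2
          have "rank \<A> q' \<le> k" if "q' \<in> S0 \<union> S1" for q'
            using delta2_weak[OF r 2(2,3)] that h(3) by (auto simp: Q_le_def)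
          then show ?thesis using 2 succ unfolding locally_won_def by blast
        qed blast
        with r h(3) show "(t', r) \<in> layer_step k (region k) X" by (simp add: layer_step_def)
      qed
      then have "X \<subseteq> layer k (region k)" using True by (simp add: layer_def gfp_upperbound)
      moreover have "(t', r) \<in> X" using less.prems unfolding X_def by blast
      ultimately show ?thesis by auto
    next
      case False
      define bad where "bad h \<longleftrightarrow> ?hist h \<and> (\<exists>v r t'. last h = EveAt v r \<and> rank \<A> r = k \<and> subtree t v = Some t' \<and>
        (t', r) \<notin> region (Suc k))" for h
      \<comment> \<open>If no extension by two moves were bad, all successors would lie in the
        region, and \<open>region_iff\<close> would put the last position there as well.\<close>
      have extend: "\<exists>p p'. bad (h @ [p, p'])" if "bad h" for h
      proof (rule ccontr)
        assume no: "\<not> ?thesis"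
        from that obtain v r t' where h: "?hist h" "last h = EveAt v r" "rank \<A> r = k" "subtree t v = Some t'"
            "(t', r) \<notin> region (Suc k)" by (auto simp: bad_def)
        have succ: "(t'', q') \<in> region (Suc k)"
          if "?hist (h @ [\<sigma> h, EveAt v' q'])" "rank \<A> q' \<le> k" "subtree t v' = Some t''" for v' q' t''
        proof (cases "rank \<A> q' < k")
          case True
          then show ?thesis using lower[OF that(1)] that by simp
        next
          case False
          with that no show ?thesis unfolding bad_def by fastforce
        qed
        from step[OF h(1,2)] h(4) have r: "r \<in> states \<A>" by auto
        from step[OF h(1,2)] h(4) consider "\<forall>Z. locally_won Z t' r" |
          a t0 t1 S0 S1 where "t' = BNode [] (HConst a) [t0, t1]" "signature \<A> a = Some (\<o> \<rightarrow> \<o> \<rightarrow> \<o>)"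
            "(S0, S1) \<in> delta2 \<A> r a" "subtree t (v @ [0]) = Some t0" "subtree t (v @ [1]) = Some t1"
            "\<forall>q' \<in> S0. ?hist (h @ [\<sigma> h, EveAt (v @ [0]) q'])" "\<forall>q' \<in> S1. ?hist (h @ [\<sigma> h, EveAt (v @ [1]) q'])"
          by auto
        then have "locally_won (region (Suc k)) t' r"
        proof cases
          case 2
          have "rank \<A> q' \<le> k" if "q' \<in> S0 \<union> S1" for q'
            using delta2_weak[OF r 2(2,3)] that h(3) by (auto simp: Q_le_def)
          then show ?thesis using 2 succ unfolding locally_won_def by blast
        qed blast
        with r h(3,5) region_iff[of t' r "Suc k"] show False by simp
      qed
      show ?thesis
      proof (rule ccontr)
        assume "(t', r) \<notin> region (Suc k)"
        with less.prems have "bad h" by (auto simp: bad_def)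
        then have "\<exists>H. \<forall>n. bad (H n) \<and> (\<exists>p p'. H (Suc n) = H n @ [p, p'])"
          using extend by (intro dependent_nat_choice[of "\<lambda>_. bad"]) blast+
        then obtain H where bad: "\<And>n. bad (H n)" and H: "\<And>n. \<exists>p p'. H (Suc n) = H n @ [p, p']" by blast
        have len: "n < length (H n)" for n
        proof (induction n)
          case 0
          then show ?case using bad[of 0] history_nonempty by (auto simp: bad_def)
        next
          case (Suc n)
          then show ?case using H[of n] by auto
        qed
        have prefix: "i < length (H m) \<Longrightarrow> H (m + d) ! i = H m ! i \<and> i < length (H (m + d))" for i m d
        proof (induction d)
          case (Suc d)
          then show ?case using H[of "m + d"] by (auto simp: nth_append)
        qed simp
        \<comment> \<open>The \<open>H n\<close> extend one another and \<open>H n\<close> is longer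
          than \<open>n\<close>, so the diagonal is the infinite play they approximate.\<close>
        define \<pi> where "\<pi> i = H i ! i" for i
        have \<pi>: "\<pi> i = H n ! i" if "i < length (H n)" for i n
        proof (cases "i \<le> n")
          case True
          then show ?thesis using prefix[OF len[of i], of "n - i"] by (simp add: \<pi>_def)
        next
          case False
          then show ?thesis using prefix[OF that, of "i - n"] by (simp add: \<pi>_def)
        qed
        have "map \<pi> [0..<Suc n] = take (Suc n) (H n)" for n
          using len[of n] \<pi>[of _ n] by (intro nth_equalityI) (auto simp del: upt_Suc)
        then have "infinite_play \<A> t q \<sigma> \<pi>"
          using history_take[OF _ len] bad by (auto simp: infinite_play_def bad_def)
        moreover have "\<forall>\<pi>. infinite_play \<A> t q \<sigma> \<pi> \<longrightarrow>
            (\<exists>n k. even k \<and> (\<forall>i \<ge> n. \<forall>v r. \<pi> i = EveAt v r \<longrightarrow> rank \<A> r = k))"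
          using \<sigma> unfolding winning_strategy_def by (elim conjE)
        ultimately obtain n k' where k': "even k'" "\<And>i v r. i \<ge> n \<Longrightarrow> \<pi> i = EveAt v r \<Longrightarrow> rank \<A> r = k'"
          by meson
        \<comment> \<open>\<open>H n\<close> ends in rank \<open>k\<close> at an index not below
          \<open>n\<close>, so the eventual even rank would equal the odd \<open>k\<close>.\<close>
        obtain v r where "last (H n) = EveAt v r" "rank \<A> r = k" using bad[of n] by (auto simp: bad_def)
        moreover have "\<pi> (length (H n) - 1) = last (H n)"
          using \<pi>[of "length (H n) - 1" n] len[of n] by (subst last_conv_nth) auto
        ultimately have "k = k'" using k'(2)[of "length (H n) - 1" v r] len[of n] by simp
        with k'(1) False show False by simp
      qed
    qed
  qed
  from this[OF history.intros(1)] show ?thesis by simp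
qed

section \<open>The interpretation computes the winning region\<close>

lemma closed_BT_cases:
  assumes "typed [] M \<o>"
  obtains (Omega) "BT M = BOmega"
  | (Leaf) c where "BT M = BNode [] (HConst c) []" "signature \<A> c = Some \<o>" "red\<^sup>*\<^sup>* M (Const c)"
  | (Node) a N0 N1 where "BT M = BNode [] (HConst a) [BT N0, BT N1]" "signature \<A> a = Some (\<o> \<rightarrow> \<o> \<rightarrow> \<o>)"
      "typed [] N0 \<o>" "typed [] N1 \<o>" "red\<^sup>*\<^sup>* M (App (App (Const a) N0) N1)"
proof (cases "hnf M")
  case None
  then show ?thesis using Omega BT_None by blast
next
  case (Some r)
  obtain As h Ns where r: "r = (As, h, Ns)" by (cases r)
  have "ran (signature \<A>) \<subseteq> {\<o>, \<o> \<rightarrow> \<o> \<rightarrow> \<o>}" using alternating by (simp add: alternating_automaton_def)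
  from hnf_closed_base[OF assms this Some[unfolded r]] BT_Some[OF Some[unfolded r]] hnf_SomeD[OF Some[unfolded r]]
  show ?thesis using Leaf Node by auto
qed

lemma subtree_BT: "typed [] M \<o> \<Longrightarrow> subtree (BT M) v = Some t \<Longrightarrow> \<exists>N. typed [] N \<o> \<and> t = BT N"
proof (induction v arbitrary: M)
  case (Cons i v)
  from Cons.prems(1) show ?case
  proof (cases rule: closed_BT_cases)
    case (Node a N0 N1)
    with Cons.prems(2) have "subtree ([BT N0, BT N1] ! i) v = Some t" "i < 2"
      by (auto split: if_splits)
    then have "subtree (BT N0) v = Some t \<or> subtree (BT N1) v = Some t"
      by (auto simp: less_2_cases_iff)
    with Node Cons.IH show ?thesis by blast
  qed (use Cons.prems(2) in \<open>auto simp: BT_None\<close>)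
qed auto

lemma binary_labelled_BT: "typed [] M \<o> \<Longrightarrow> binary_labelled (BT M)"
  unfolding binary_labelled_def
proof (intro allI impI)
  fix v a t0 t1 assume "typed [] M \<o>" "subtree (BT M) v = Some (BNode [] (HConst a) [t0, t1])"
  then obtain N where N: "typed [] N \<o>" "BT N = BNode [] (HConst a) [t0, t1]"
    using subtree_BT by metis
  from N(1) show "signature \<A> a = Some (\<o> \<rightarrow> \<o> \<rightarrow> \<o>)"
    by (cases rule: closed_BT_cases) (use N(2) in auto)
qed

text \<open>The index is shifted because \<open>region (Suc k)\<close> covers the ranks up to and
  including \<open>k\<close>, like \<open>Qle k\<close>.\<close>

definition win_set :: "nat \<Rightarrow> 'c tm \<Rightarrow> 'q set" where
  "win_set k M = {q. (BT M, q) \<in> region (Suc k)}"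

lemma sem_node:
  assumes "signature \<A> a = Some (\<o> \<rightarrow> \<o> \<rightarrow> \<o>)" "d0 \<in> D k \<o>" "d1 \<in> D k \<o>"
  shows "vapp (vapp (const_interp \<A> k a) d0) d1 = VSet (const2 \<A> k a (the_set d0) (the_set d1))"
  using assms by (simp add: const_interp_binary del: Dom.simps)

section \<open>The logical relation between closed terms and elements of the model\<close>

definition compat :: "nat \<Rightarrow> ty \<Rightarrow> 'c tm \<Rightarrow> 'q val \<Rightarrow> bool" where
  "compat k A M d \<longleftrightarrow> typed [] M A \<and> d \<in> D k A \<and> (\<forall>j. k = Suc j \<longrightarrow> (sem j [] M, d) \<in> L j A)"

text \<open>For even \<open>k\<close> the elements related to \<open>M\<close> bound the winning set from above, for odd \<open>k\<close> from below.
  Only elements over the interpretation of \<open>M\<close> one level down take part, so that nothing needs to be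
  known about the relation at level \<open>k - 1\<close>.\<close>

primrec logrel :: "nat \<Rightarrow> ty \<Rightarrow> 'c tm \<Rightarrow> 'q val \<Rightarrow> bool" where
  "logrel k \<o> M d \<longleftrightarrow> compat k \<o> M d \<and> (if even k then win_set k M \<subseteq> the_set d else the_set d \<subseteq> win_set k M)"
| "logrel k (A \<rightarrow> B) M f \<longleftrightarrow> compat k (A \<rightarrow> B) M f \<and> (\<forall>N d. logrel k A N d \<longrightarrow> logrel k B (App M N) (vapp f d))"

lemma logrel_compat: "logrel k A M d \<Longrightarrow> compat k A M d"
  by (cases A) auto

lemma compat_app: "compat k (A \<rightarrow> B) M f \<Longrightarrow> compat k A N d \<Longrightarrow> compat k B (App M N) (vapp f d)"
  unfolding compat_def by (auto intro: has_type.intros D_app L_app)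

text \<open>The relation sees a term only through its type, Boehm tree and interpretation, the last
  two invariant under reduction. The type of \<open>M'\<close> is given separately because reduction
  does not reflect typing.\<close>

lemma logrel_expand: "red M' M \<Longrightarrow> typed [] M' A \<Longrightarrow> logrel k A M d \<Longrightarrow> logrel k A M' d"
proof (induction A arbitrary: M M' d)
  case Base
  have "red\<^sup>*\<^sup>* M' M" using Base(1) by simp
  then have "win_set k M' = win_set k M" by (simp only: win_set_def reds_BT)
  with Base \<open>red\<^sup>*\<^sup>* M' M\<close> show ?case using sem_reds[of M' M \<o>] by (simp add: compat_def)
next
  case (Arr A B)
  have "red\<^sup>*\<^sup>* M' M" using Arr.prems(1) by simp
  then have "compat k (A \<rightarrow> B) M' d"
    using Arr.prems sem_reds[of M' M "A \<rightarrow> B"] by (simp add: compat_def)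
  moreover have "logrel k B (App M' N) (vapp d e)" if N: "logrel k A N e" for N e
  proof (rule Arr.IH(2))
    show "red (App M' N) (App M N)" using Arr.prems(1) by (rule red.intros)
    show "typed [] (App M' N) B" using Arr.prems(2) logrel_compat[OF N] by (auto simp: compat_def intro: has_type.intros)
    show "logrel k B (App M N) (vapp d e)" using Arr.prems(3) N by simp
  qed
  ultimately show ?case by simp
qed

text \<open>The greatest element compatible with \<open>M\<close> for even \<open>k\<close>, the
  least for odd \<open>k\<close>. For a term \<open>App (Y A) F\<close> it is the starting point of
  the iteration.\<close>

primrec extremal :: "nat \<Rightarrow> ty \<Rightarrow> 'c tm \<Rightarrow> 'q val" where
  "extremal 0 A M = Top \<A> 0 A"
| "extremal (Suc k) A M = up (even (Suc k)) k A (sem k [] M)"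

lemma compat_extremal: "typed [] M A \<Longrightarrow> compat k A M (extremal k A M)"
proof (cases k)
  case 0
  then show "typed [] M A \<Longrightarrow> ?thesis" using Top_greatest[of A] by (simp add: compat_def is_greatest_def)
next
  case (Suc j)
  then show "typed [] M A \<Longrightarrow> ?thesis"
    using up_L[OF sem_closed_D] L_D(2)[OF up_L[OF sem_closed_D]] by (simp add: compat_def)
qed

text \<open>Compatibility puts \<open>d\<close> over the interpretation of \<open>N\<close>, so
  \<open>up_app\<close> yields the lift of the interpretation of \<open>App M N\<close>. Here the
  restriction of the relation to compatible elements pays off.\<close>

lemma extremal_app: "compat k A N d \<Longrightarrow> vapp (extremal k (A \<rightarrow> B) M) d = extremal k B (App M N)"
proof (cases k)
  case 0
  then show "compat k A N d \<Longrightarrow> ?thesis" by (simp add: compat_def Top_app)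
next
  case (Suc j)
  assume "compat k A N d"
  then have "(sem j [] N, d) \<in> L j A" using Suc by (simp add: compat_def)
  from up_app[OF this] show ?thesis unfolding Suc extremal.simps interp.simps .
qed

definition exact :: "nat \<Rightarrow> bool" where
  "exact k \<longleftrightarrow> (\<forall>M. typed [] M \<o> \<longrightarrow> the_set (sem k [] M) = win_set k M)"

lemma region_Qle: "(t, q) \<in> region (Suc k) \<Longrightarrow> q \<in> Qle k"
  using region_rank by (fastforce simp: Q_le_def)

text \<open>At type o the extremal element is the winning set for lower ranks, exact by assumption,
  with all states of rank \<open>k\<close> added or none. Higher types reduce to this by
  \<open>extremal_app\<close>.\<close>

lemma logrel_extremal:
  assumes "\<forall>j. k = Suc j \<longrightarrow> exact j"
  shows "typed [] M A \<Longrightarrow> logrel k A M (extremal k A M)"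
proof (induction A arbitrary: M)
  case Base
  have "if even k then win_set k M \<subseteq> the_set (extremal k \<o> M) else the_set (extremal k \<o> M) \<subseteq> win_set k M"
  proof (cases k)
    case 0
    then show ?thesis using region_Qle by (auto simp: win_set_def Top_Base)
  next
    case (Suc j)
    with assms Base have sem: "the_set (sem j [] M) = win_set j M" by (simp add: exact_def)
    have "win_set j M \<subseteq> win_set k M" unfolding win_set_def Suc by auto
    moreover have "win_set k M \<subseteq> win_set j M \<union> (Qle k - Qle j)"
    proof
      fix q assume q: "q \<in> win_set k M"
      show "q \<in> win_set j M \<union> (Qle k - Qle j)"
      proof (cases "rank \<A> q \<le> j")
        case True
        then show ?thesis using q region_rank_iff[of "BT M" q "Suc k"] region_rank_iff[of "BT M" q "Suc j"]
          by (simp add: win_set_def)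
      next
        case False
        then show ?thesis using q region_Qle[of "BT M" q k] by (auto simp: win_set_def Q_le_def)
      qed
    qed
    ultimately show ?thesis unfolding Suc extremal.simps up.simps by (simp add: sem)
  qed
  with compat_extremal[OF Base] show ?case by simp
next
  case (Arr A B)
  have "logrel k B (App M N) (vapp (extremal k (A \<rightarrow> B) M) d)" if "logrel k A N d" for N d
  proof -
    have N: "compat k A N d" using that by (rule logrel_compat)
    then have "typed [] (App M N) B" using Arr.prems by (auto simp: compat_def intro: has_type.intros)
    then show ?thesis unfolding extremal_app[OF N] by (rule Arr.IH(2))
  qed
  with compat_extremal[OF Arr.prems] show ?case by simp
qed

text \<open>\<open>f\<close> lies over the interpretation of \<open>F\<close>, so the fixpoint that
  \<open>fix_start\<close> lifts is the lower interpretation of \<open>App (Y A) F\<close>.\<close>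

lemma fixp_iterate_extremal:
  assumes "compat k (A \<rightarrow> A) F f"
  shows "\<exists>n. fixp \<A> k A f = (vapp f ^^ n) (extremal k A (App (Y A) F))"
proof -
  have F: "typed [] F (A \<rightarrow> A)" and f: "f \<in> D k (A \<rightarrow> A)" using assms by (auto simp: compat_def)
  have "fix_start k A f = extremal k A (App (Y A) F)"
  proof (cases k)
    case (Suc j)
    then have "dn j (A \<rightarrow> A) f = sem j [] F" using assms L_dn[of "sem j [] F" f] by (simp add: compat_def del: dn.simps)
    then show ?thesis unfolding Suc using sem_closed_D[OF F, of j] by (simp del: dn.simps)
  qed simp
  then show ?thesis using fixp_properties[OF f] by simp
qed

lemma logrel_fixp:
  assumes exact: "\<forall>j. k = Suc j \<longrightarrow> exact j" and F: "logrel k (A \<rightarrow> A) F f"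
  shows "logrel k A (App (Y A) F) (fixp \<A> k A f)"
proof -
  have tyF: "typed [] F (A \<rightarrow> A)" using logrel_compat[OF F] by (simp add: compat_def)
  then have ty: "typed [] (App (Y A) F) A" by (auto intro: has_type.intros)
  have "logrel k A (App (Y A) F) ((vapp f ^^ n) (extremal k A (App (Y A) F)))" for n
  proof (induction n)
    case 0
    show ?case using logrel_extremal[OF exact ty] by simp
  next
    case (Suc n)
    then have "logrel k A (App F (App (Y A) F)) ((vapp f ^^ Suc n) (extremal k A (App (Y A) F)))"
      using F by simp
    then show ?case by (rule logrel_expand[OF red.delta ty])
  qed
  then show ?thesis using fixp_iterate_extremal[OF logrel_compat[OF F]] by metis
qed

lemma compat_csubst:
  assumes M: "typed \<Gamma> M A" and len: "length Ns = length \<Gamma>"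
    and env: "\<And>i. i < length \<Gamma> \<Longrightarrow> compat k (\<Gamma> ! i) (Ns ! i) (ds ! i)"
  shows "compat k A (csubst 0 Ns M) (sem k ds M)"
proof -
  have Ns: "list_all2 (typed []) Ns \<Gamma>" using len env by (auto simp: list_all2_conv_all_nth compat_def)
  have "typed [] (csubst 0 Ns M) A" using has_type_csubst[of _ "[]" \<Gamma> M A Ns] M Ns by simp
  moreover have "sem k ds M \<in> D k A"
    by (rule sem_D[OF M]) (use env in \<open>auto simp: env_le_def compat_def le_refl\<close>)
  moreover have "(sem j [] (csubst 0 Ns M), sem k ds M) \<in> L j A" if "k = Suc j" for j
  proof -
    have "env_L j \<Gamma> (map (sem j []) Ns) ds" using env that len by (auto simp: env_L_def compat_def)
    from sem_L[OF M this] show ?thesis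
      using sem_csubst[of "[]" \<Gamma> M A Ns "[]" j] M Ns that by simp
  qed
  ultimately show ?thesis by (simp add: compat_def)
qed

lemma logrel_Const:
  assumes c: "signature \<A> c = Some A"
  shows "logrel k A (Const c) (const_interp \<A> k c)"
proof -
  have compat: "compat k A (Const c) (const_interp \<A> k c)"
    using compat_csubst[OF has_type.intros(2)[of "signature \<A>" c A "[]"], of "[]" k "[]"] c by simp
  show ?thesis
  proof (cases rule: signature_cases[OF c])
    case 1
    have "BT (Const c) = BNode [] (HConst c) []" using BT_hnf_tm[of "[]" "HConst c" "[]"] by simp
    then have "win_set k (Const c) = the_set (const_interp \<A> k c)"
      unfolding win_set_def region_iff[of _ _ "Suc k"] using c 1
      by (auto simp: locally_won_def const_interp_def Q_le_def)
    with compat 1 show ?thesis by simp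
  next
    case 2
    have a: "signature \<A> c = Some (\<o> \<rightarrow> \<o> \<rightarrow> \<o>)" using c 2 by simp
    have "logrel k \<o> (App (App (Const c) N0) N1) (vapp (vapp (const_interp \<A> k c) d0) d1)"
      if N0: "logrel k \<o> N0 d0" and N1: "logrel k \<o> N1 d1" for N0 d0 N1 d1
    proof -
      let ?M = "App (App (Const c) N0) N1" and ?d = "vapp (vapp (const_interp \<A> k c) d0) d1"
      have cpt: "compat k \<o> ?M ?d"
        using compat_app[OF compat_app[OF compat[unfolded 2] logrel_compat[OF N0]] logrel_compat[OF N1]] .
      have D: "d0 \<in> D k \<o>" "d1 \<in> D k \<o>" using logrel_compat[OF N0] logrel_compat[OF N1] by (auto simp: compat_def)
      have d: "the_set ?d = const2 \<A> k c (the_set d0) (the_set d1)" using sem_node[OF a D] by simp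
      have "BT ?M = BNode [] (HConst c) [BT N0, BT N1]" using BT_hnf_tm[of "[]" "HConst c" "[N0, N1]"] by simp
      then have win: "q \<in> win_set k ?M \<longleftrightarrow> q \<in> Qle k \<and>
          (\<exists>S0 S1. (S0, S1) \<in> delta2 \<A> q c \<and> S0 \<subseteq> win_set k N0 \<and> S1 \<subseteq> win_set k N1)" for q
        unfolding win_set_def using region_iff[of "BT ?M" q "Suc k"] a
        by (auto simp: locally_won_def Q_le_def subset_iff less_Suc_eq_le simp del: region.simps) blast
      show ?thesis
      proof (cases "even k")
        case True
        then have sub: "win_set k N0 \<subseteq> the_set d0" "win_set k N1 \<subseteq> the_set d1" using N0 N1 by auto
        have "win_set k ?M \<subseteq> the_set ?d"
        proof
          fix q assume "q \<in> win_set k ?M"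
          then obtain S0 S1 where q: "q \<in> Qle k" "q \<in> states \<A>" and S: "(S0, S1) \<in> delta2 \<A> q c"
            "S0 \<subseteq> the_set d0" "S1 \<subseteq> the_set d1" using win sub by (auto simp: Q_le_def)
          \<comment> \<open>Monotonicity enlarges Eve's move to the cut arguments that
            \<open>const2\<close> tests. In the odd case the cut arguments are themselves her
            move.\<close>
          have "S0 \<subseteq> Qle (rank \<A> q)" "S1 \<subseteq> Qle (rank \<A> q)" using delta2_weak[OF q(2) a S(1)] by auto
          with S(2,3) have "(the_set d0 \<inter> Qle (rank \<A> q), the_set d1 \<inter> Qle (rank \<A> q)) \<in> delta2 \<A> q c"
            by (intro delta2_mono[OF q(2) a S(1)]) auto
          with q(1) show "q \<in> the_set ?d" unfolding d by (simp add: const2_def)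
        qed
        with cpt True show ?thesis by simp
      next
        case False
        then have sub: "the_set d0 \<subseteq> win_set k N0" "the_set d1 \<subseteq> win_set k N1" using N0 N1 by auto
        have "the_set ?d \<subseteq> win_set k ?M"
        proof
          fix q assume "q \<in> the_set ?d"
          then have "q \<in> Qle k" "(the_set d0 \<inter> Qle (rank \<A> q), the_set d1 \<inter> Qle (rank \<A> q)) \<in> delta2 \<A> q c"
            unfolding d by (auto simp: const2_def)
          with sub show "q \<in> win_set k ?M" unfolding win by blast
        qed
        with cpt False show ?thesis by simp
      qed
    qed
    moreover have "compat k (\<o> \<rightarrow> \<o>) (App (Const c) N0) (vapp (const_interp \<A> k c) d0)" if "logrel k \<o> N0 d0" for N0 d0
      using compat_app[OF compat[unfolded 2] logrel_compat[OF that]] .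
    ultimately show ?thesis using compat unfolding 2 logrel.simps(2) by blast
  qed
qed

text \<open>For an abstraction, the body under the extended substitution is the contractum of the
  applied abstraction, and \<open>logrel_expand\<close> leads back to the redex.\<close>

lemma logrel_fundamental:
  assumes exact: "\<forall>j. k = Suc j \<longrightarrow> exact j"
  shows "typed \<Gamma> M A \<Longrightarrow> length Ns = length \<Gamma> \<Longrightarrow>
    (\<And>i. i < length \<Gamma> \<Longrightarrow> logrel k (\<Gamma> ! i) (Ns ! i) (ds ! i)) \<Longrightarrow> logrel k A (csubst 0 Ns M) (sem k ds M)"
proof (induction arbitrary: Ns ds rule: has_type.induct)
  case (1 i \<Gamma>)
  then show ?case by simp
next
  case (2 c A \<Gamma>)
  then show ?case using logrel_Const by simp
next
  case (3 \<Gamma> A)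
  have "compat k ((A \<rightarrow> A) \<rightarrow> A) (Y A) (sem k ds (Y A))"
    using compat_csubst[OF has_type.intros(3)[of "signature \<A>" "[]" A], of "[]" k ds] by simp
  moreover have "logrel k A (App (Y A) F) (vapp (sem k ds (Y A)) f)" if F: "logrel k (A \<rightarrow> A) F f" for F f
    using logrel_fixp[OF exact F] logrel_compat[OF F] by (simp add: compat_def)
  ultimately show ?case by simp
next
  case (4 A \<Gamma> M B)
  have compat: "compat k (A \<rightarrow> B) (csubst 0 Ns (Lam A M)) (sem k ds (Lam A M))"
    using 4 by (intro compat_csubst[of \<Gamma>]) (auto intro: has_type.intros logrel_compat)
  have Ns: "list_all2 (typed []) Ns \<Gamma>"
    using 4(3) logrel_compat[OF 4(4)] by (auto simp: list_all2_conv_all_nth compat_def)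
  have "logrel k B (App (csubst 0 Ns (Lam A M)) N) (vapp (sem k ds (Lam A M)) d)" if N: "logrel k A N d" for N d
  proof -
    have tyN: "typed [] N A" and d: "d \<in> D k A" using logrel_compat[OF N] by (auto simp: compat_def)
    have "logrel k B (csubst 0 (N # Ns) M) (sem k (d # ds) M)"
      by (rule 4(2)) (use 4(3,4) N in \<open>auto simp: nth_Cons split: nat.split\<close>)
    moreover have "csubst 0 (N # Ns) M = subst (csubst (Suc 0) Ns M) N 0"
      using subst_csubst[of _ "[]" A \<Gamma> M B Ns N] 4(1) Ns tyN by simp
    moreover have "typed [] (App (Lam A (csubst (Suc 0) Ns M)) N) B"
      using compat tyN by (auto simp: compat_def intro: has_type.intros)
    ultimately have "logrel k B (App (Lam A (csubst (Suc 0) Ns M)) N) (sem k (d # ds) M)"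
      using logrel_expand[OF red.beta] by metis
    then show ?thesis using d by simp
  qed
  with compat show ?case by simp
next
  case (5 \<Gamma> M A B N)
  then show ?case using 5(3)[of Ns ds] 5(4)[of Ns ds] by simp
qed

section \<open>Exactness at every level\<close>

lemma sem_bounds_win_set:
  assumes "\<forall>j. k = Suc j \<longrightarrow> exact j" "typed [] M \<o>"
  shows "if even k then win_set k M \<subseteq> the_set (sem k [] M) else the_set (sem k [] M) \<subseteq> win_set k M"
  using logrel_fundamental[OF assms, of "[]" "[]"] csubst_Nil[OF assms(2)] by (simp split: if_splits)

text \<open>Coherence between levels and exactness one level down settle all ranks below
  \<open>k\<close>, leaving only rank \<open>k\<close> to the (co)induction.\<close>

lemma sem_lower:
  assumes "\<forall>j. k = Suc j \<longrightarrow> exact j" "typed [] M \<o>" "q \<in> states \<A>" "rank \<A> q < k"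
  shows "q \<in> the_set (sem k [] M) \<longleftrightarrow> (BT M, q) \<in> region k"
proof -
  obtain j where j: "k = Suc j" using assms(4) by (cases k) auto
  with assms have "the_set (sem j [] M) = win_set j M" by (simp add: exact_def)
  moreover have "the_set (sem j [] M) = the_set (sem k [] M) \<inter> Qle j"
    using sem_closed_L[OF assms(2), of j] j by simp
  moreover have "q \<in> Qle j" using assms(3,4) j by (simp add: Q_le_def)
  ultimately show ?thesis unfolding j win_set_def by blast
qed

lemma sem_red_node:
  assumes "typed [] M \<o>" "red\<^sup>*\<^sup>* M (App (App (Const a) N0) N1)" "signature \<A> a = Some (\<o> \<rightarrow> \<o> \<rightarrow> \<o>)"
    and "typed [] N0 \<o>" "typed [] N1 \<o>"
  shows "the_set (sem k [] M) = const2 \<A> k a (the_set (sem k [] N0)) (the_set (sem k [] N1))"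
  using sem_reds[OF assms(2,1)] sem_node[OF assms(3) sem_closed_D[OF assms(4)] sem_closed_D[OF assms(5)]] by simp

lemma sem_red_leaf:
  assumes "typed [] M \<o>" "red\<^sup>*\<^sup>* M (Const c)" "signature \<A> c = Some \<o>"
  shows "the_set (sem k [] M) = {q \<in> Qle k. delta0 \<A> q c \<noteq> {}}"
  using sem_reds[OF assms(2,1)] assms(3) by (simp add: const_interp_def)

lemma even_sem_in_layer:
  assumes exact: "\<forall>j. k = Suc j \<longrightarrow> exact j" and "even k"
    and "typed [] M \<o>" "q \<in> the_set (sem k [] M)" "rank \<A> q = k"
  shows "(BT M, q) \<in> layer k (region k)"
proof -
  define X where "X = {(BT M, q) | M q. typed [] M \<o> \<and> q \<in> the_set (sem k [] M) \<and> rank \<A> q = k}"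
  have "X \<subseteq> layer_step k (region k) X"
  proof
    fix x assume "x \<in> X"
    then obtain M q where x: "x = (BT M, q)" and M: "typed [] M \<o>" and q: "q \<in> the_set (sem k [] M)" "rank \<A> q = k"
      by (auto simp: X_def)
    have Qle: "q \<in> Qle k" and st: "q \<in> states \<A>"
      using sem_closed_the_set[OF M, of k] q by (auto simp: Q_le_def)
    from M have "locally_won (X \<union> region k) (BT M) q"
    proof (cases rule: closed_BT_cases)
      case Omega
      then show ?thesis using \<open>even k\<close> q by (simp add: locally_won_def)
    next
      case (Leaf c)
      then show ?thesis using sem_red_leaf[OF M Leaf(3,2), of k] q by (auto simp: locally_won_def)
    next
      case (Node a N0 N1)
      have succ: "(BT N, q') \<in> X \<union> region k"
        if "typed [] N \<o>" "q' \<in> the_set (sem k [] N) \<inter> Qle k" for N q'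
        using that sem_lower[OF exact that(1), of q'] unfolding X_def Q_le_def
        by (cases "rank \<A> q' = k") auto
      \<comment> \<open>As \<open>q\<close> has rank \<open>k\<close>, the test in
        \<open>const2\<close> cuts exactly at \<open>k\<close>, and the cut sets serve as Eve's
        move.\<close>
      have "(the_set (sem k [] N0) \<inter> Qle k, the_set (sem k [] N1) \<inter> Qle k) \<in> delta2 \<A> q a"
        using q sem_red_node[OF M Node(5,2,3,4), of k] by (simp add: const2_def)
      then show ?thesis using Node(1,2) succ[OF Node(3)] succ[OF Node(4)] unfolding locally_won_def by blast
    qed
    then show "x \<in> layer_step k (region k) X" using st q(2) by (simp add: x layer_step_def)
  qed
  then have "X \<subseteq> layer k (region k)" using \<open>even k\<close> by (simp add: layer_def gfp_upperbound)
  with assms(3-5) show ?thesis unfolding X_def by blast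
qed

lemma odd_layer_in_sem:
  assumes exact: "\<forall>j. k = Suc j \<longrightarrow> exact j" and "odd k"
    and "typed [] M \<o>" "(BT M, q) \<in> layer k (region k)"
  shows "q \<in> the_set (sem k [] M)"
proof -
  \<comment> \<open>Different terms can share a tree, so the invariant asks for all of them; no
    proof that equal trees have equal interpretations is then required. The even case dually takes
    some term.\<close>
  define X where "X = {(t, q). \<forall>M. typed [] M \<o> \<longrightarrow> t = BT M \<longrightarrow> q \<in> the_set (sem k [] M)}"
  have "layer_step k (region k) X \<subseteq> X"
  proof
    fix x assume "x \<in> layer_step k (region k) X"
    then obtain t q where x: "x = (t, q)" and q: "q \<in> states \<A>" "rank \<A> q = k"
      and won: "locally_won (X \<union> region k) t q" by (auto simp: layer_step_def)
    have "q \<in> the_set (sem k [] M)" if M: "typed [] M \<o>" and t: "t = BT M" for M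
      using M
    proof (cases rule: closed_BT_cases)
      case Omega
      then show ?thesis using won t q \<open>odd k\<close> by (simp add: locally_won_def BT_None)
    next
      case (Leaf c)
      then show ?thesis using sem_red_leaf[OF M Leaf(3,2), of k] q won t by (auto simp: locally_won_def Q_le_def)
    next
      case (Node a N0 N1)
      from won t Node(1) obtain S0 S1 where S: "(S0, S1) \<in> delta2 \<A> q a"
          "\<forall>q' \<in> S0. (BT N0, q') \<in> X \<union> region k" "\<forall>q' \<in> S1. (BT N1, q') \<in> X \<union> region k"
        by (auto simp: locally_won_def)
      have succ: "q' \<in> the_set (sem k [] N)" if "typed [] N \<o>" "(BT N, q') \<in> X \<union> region k" for N q'
        using that sem_lower[OF exact that(1), of q'] region_rank[of "BT N" q' k] by (auto simp: X_def)
      have "S0 \<subseteq> Qle k" "S1 \<subseteq> Qle k" using delta2_weak[OF q(1) Node(2) S(1)] q(2) by auto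
      moreover have "S0 \<subseteq> the_set (sem k [] N0)" "S1 \<subseteq> the_set (sem k [] N1)"
        using S(2,3) succ[OF Node(3)] succ[OF Node(4)] by auto
      ultimately have "(the_set (sem k [] N0) \<inter> Qle (rank \<A> q), the_set (sem k [] N1) \<inter> Qle (rank \<A> q)) \<in> delta2 \<A> q a"
        using q(2) by (intro delta2_mono[OF q(1) Node(2) S(1)]) auto
      then show ?thesis using sem_red_node[OF M Node(5,2,3,4), of k] q by (simp add: const2_def Q_le_def)
    qed
    then show "x \<in> X" unfolding x X_def by blast
  qed
  then have "layer k (region k) \<subseteq> X" using \<open>odd k\<close> by (simp add: layer_def lfp_lowerbound)
  with assms(3,4) show ?thesis unfolding X_def by blast
qed

lemma exact_level: "exact k"
proof (induction k rule: less_induct)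
  case (less k)
  then have exact: "\<forall>j. k = Suc j \<longrightarrow> exact j" by simp
  show ?case
    unfolding exact_def
  proof (intro allI impI)
    fix M assume M: "typed [] M \<o>"
    have lower: "q \<in> the_set (sem k [] M) \<longleftrightarrow> q \<in> win_set k M" if "q \<in> states \<A>" "rank \<A> q < k" for q
      using sem_lower[OF exact M that] that region_rank_iff[of "BT M" q k] region_rank_iff[of "BT M" q "Suc k"]
      by (simp add: win_set_def)
    have "if even k then the_set (sem k [] M) \<subseteq> win_set k M else win_set k M \<subseteq> the_set (sem k [] M)"
    proof (cases "even k")
      case True
      have "q \<in> win_set k M" if q: "q \<in> the_set (sem k [] M)" for q
      proof -
        have "q \<in> states \<A>" "rank \<A> q \<le> k" using sem_closed_the_set[OF M, of k] q by (auto simp: Q_le_def)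
        then show ?thesis using lower[of q] q even_sem_in_layer[OF exact True M q]
          by (cases "rank \<A> q = k") (auto simp: win_set_def)
      qed
      with True show ?thesis by auto
    next
      case False
      have "q \<in> the_set (sem k [] M)" if q: "q \<in> win_set k M" for q
      proof -
        have "q \<in> states \<A>" "rank \<A> q \<le> k" using region_Qle[of "BT M" q k] q by (auto simp: Q_le_def win_set_def)
        then show ?thesis using lower[of q] q odd_layer_in_sem[OF exact False M, of q] region_layer[of q k "BT M"]
          by (cases "rank \<A> q = k") (auto simp: win_set_def simp del: region.simps)
      qed
      with False show ?thesis by auto
    qed
    with sem_bounds_win_set[OF exact M] show "the_set (sem k [] M) = win_set k M" by (meson subset_antisym)
  qed
qed

lemma sem_eq_accepting_states:
  assumes M: "typed [] M \<o>"
  shows "sem k [] M = VSet (accepting_states \<A> M \<inter> Qle k)"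
proof -
  have "win_set k M = accepting_states \<A> M \<inter> Qle k"
  proof (rule set_eqI)
    fix q
    \<comment> \<open>Membership is moved to the level of the state's own rank, where acceptance is
      characterized.\<close>
    have "q \<in> win_set k M \<longleftrightarrow> q \<in> Qle k \<and> (BT M, q) \<in> region (Suc (rank \<A> q))"
      using region_rank_iff[of "BT M" q "Suc k"] region_rank[of "BT M" q "Suc k"]
      by (auto simp: win_set_def Q_le_def simp del: region.simps)
    also have "\<dots> \<longleftrightarrow> q \<in> Qle k \<and> accepts \<A> (BT M) q"
      using accepts_if_region region_if_accepts[OF _ _ binary_labelled_BT[OF M]] by (auto simp: Q_le_def)
    finally show "q \<in> win_set k M \<longleftrightarrow> q \<in> accepting_states \<A> M \<inter> Qle k"
      by (auto simp: accepting_states_def Q_le_def)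
  qed
  moreover have "the_set (sem k [] M) = win_set k M" using exact_level M by (simp add: exact_def)
  ultimately show ?thesis using sem_closed_the_set[OF M, of k] by simp
qed

end

theorem theorem4p13:
  fixes \<A> :: "('q, 'c) automaton" and M :: "'c tm" and k :: nat
  assumes "alternating_automaton \<A>"
    and "weak \<A>"
    and "monotone_transitions \<A>"
    and "has_type (signature \<A>) [] M \<o>"
    and "k \<le> max_rank \<A>"
  shows "interp \<A> k [] M = VSet (accepting_states \<A> M \<inter> Q_le \<A> k)"
proof -
  interpret weak_automaton \<A> by unfold_locales (fact assms)+
  show ?thesis using assms(4) by (rule sem_eq_accepting_states)
qed

end
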